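(* Let $\alpha>0$, $N\ge2$, $\lambda\in(-N,0]$ and let $\Omega\subset\mathbb{R}^N$ be a smooth bounded domain containing the origin. Then there exist positive constants $C_P$ and $\beta$ such that for any $x\in\Omega$ and $0<r<\beta$ we have $$\inf_{\xi\in\mathbb{R}}\int_{\mathcal B(x,r)\cap\Omega}|y|^\lambda d^\alpha(y)|f(y)-\xi|^2\,dy\ \le\ C_P\,r^2\int_{\mathcal B(x,r)\cap\Omega}|y|^\lambda d^\alpha(y)|\nabla f|^2\,dy\qquad\text{for all }f\in C^1(\overline{\mathcal B(x,r)\cap\Omega}).$$
   Context: "Smooth" domain means of class $C^2$; $d(y)=\mathrm{dist}(y,\partial\Omega)$. Local representation of $\partial\Omega$. The following representation of the boundary is used. There are a finite number $m$ of coordinate systems $(y_i',y_{iN})$, $y_i'=(y_{i1},\dots,y_{i,N-1})$, the same number of functions $a_i=a_i(y_i')$ defined on the closures $\overline\Delta_i$ of the $(N-1)$-dimensional cubes $\Delta_i=\{y_i':|y_{ij}|\le\delta,\ j=1,\dots,N-1\}$ and Lipschitz there with a constant $A>0$, and a positive number $\beta<1$, such that: for each point of $\partial\Omega$ there is at least one $i$ for which the point has the form $(y_i',a_i(y_i'))$; with $B_i=\{y_i'\in\Delta_i,\ a_i(y_i')-\beta<y_{iN}<a_i(y_i')+\beta\}$ one has $B_i\cap\Omega=\{y_i'\in\Delta_i,\ a_i(y_i')-\beta<y_{iN}<a_i(y_i')\}$ and $B_i\cap\partial\Omega=\{y_i'\in\Delta_i,\ y_{iN}=a_i(y_i')\}$;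 and $(1+A)^{-1}(a_i(y_i')-y_{iN})\le d(y)\le a_i(y_i')-y_{iN}$ for $y\in B_i\cap\Omega$. "Balls". Fix a constant $\gamma\in(1,2)$. For $x\in\Omega$ and $0<r<\beta$: if $d(x)\ge\gamma r$, $\mathcal B(x,r)=B(x,r)$ is the Euclidean ball centered at $x$ of radius $r$; if $d(x)<\gamma r$, $\mathcal B(x,r)=\{(y_i',y_{iN}):|y_i'-x_i'|\le r,\ a_i(y_i')-r-d(x)<y_{iN}<a_i(y_i')+r-d(x)\}$, where $i\in\{1,\dots,m\}$ is the index determined by the projection $\bar x\in\partial\Omega$ of $x$ onto $\partial\Omega$ ($|\bar x-x|=d(x)$). *)

theory Defs
  imports "HOL-Analysis.Analysis"
begin

text \<open>
  A Cartesian coordinate system of \<open>\<real>\<^sup>N\<close> is a surjective isometry onto \<open>\<real>\<^sup>N\<^sup>-\<^sup>1 \<times> \<real>\<close> (whose norm is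
  the Euclidean one); it sends a point \<open>p\<close> to its coordinates \<open>(y', y\<^sub>N)\<close>. The type \<open>'m\<close> plays the
  role of \<open>N - 1\<close>.
\<close>

definition coordinate_system :: "(real^'n \<Rightarrow> (real^'m) \<times> real) \<Rightarrow> bool" where
  "coordinate_system T \<longleftrightarrow> surj T \<and> (\<forall>p q. dist (T p) (T q) = dist p q)"

definition C2_function :: "('b::real_normed_vector \<Rightarrow> real) \<Rightarrow> bool" where
  "C2_function \<phi> \<longleftrightarrow>
     (\<exists>(F :: 'b \<Rightarrow> 'b \<Rightarrow>\<^sub>L real) (G :: 'b \<Rightarrow> 'b \<Rightarrow>\<^sub>L 'b \<Rightarrow>\<^sub>L real).
        (\<forall>x. (\<phi> has_derivative blinfun_apply (F x)) (at x)) \<and>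
        (\<forall>x. (F has_derivative blinfun_apply (G x)) (at x)) \<and>
        continuous_on UNIV G)"

text \<open>
  The usual definition of a \<open>C\<^sup>2\<close> boundary: near each boundary point, in suitable Cartesian
  coordinates, the set is the region below the graph of a \<open>C\<^sup>2\<close> function. The first argument only
  passes the type \<open>'m\<close>.
\<close>

definition C2_boundary :: "'m::finite itself \<Rightarrow> (real^'n) set \<Rightarrow> bool" where
  "C2_boundary _ \<Omega> \<longleftrightarrow>
     (\<forall>p\<in>frontier \<Omega>. \<exists>(T :: real^'n \<Rightarrow> (real^'m) \<times> real) \<phi> \<rho>.
        coordinate_system T \<and> C2_function \<phi> \<and> \<rho> > 0 \<and>
        \<Omega> \<inter> ball p \<rho> = {y \<in> ball p \<rho>. snd (T y) < \<phi> (fst (T y))})"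

definition bdist :: "(real^'n) set \<Rightarrow> real^'n \<Rightarrow> real" where
  "bdist \<Omega> y = infdist y (frontier \<Omega>)"

definition cube :: "real \<Rightarrow> (real^'m) set" where
  "cube \<delta> = {y. \<forall>j. \<bar>y $ j\<bar> \<le> \<delta>}"

definition on_graph ::
  "real \<Rightarrow> (real^'n \<Rightarrow> (real^'m) \<times> real) \<Rightarrow> (real^'m \<Rightarrow> real) \<Rightarrow> real^'n \<Rightarrow> bool" where
  "on_graph \<delta> T a p \<longleftrightarrow> fst (T p) \<in> cube \<delta> \<and> snd (T p) = a (fst (T p))"

definition graph_nbhd ::
  "real \<Rightarrow> real \<Rightarrow> (real^'n \<Rightarrow> (real^'m) \<times> real) \<Rightarrow> (real^'m \<Rightarrow> real) \<Rightarrow> (real^'n) set" where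
  "graph_nbhd \<delta> \<beta> T a =
     {p. fst (T p) \<in> cube \<delta> \<and> a (fst (T p)) - \<beta> < snd (T p) \<and> snd (T p) < a (fst (T p)) + \<beta>}"

text \<open>
  Local representation of the boundary by \<open>m\<close> coordinate systems \<open>T i\<close> and functions \<open>a i\<close>,
  \<open>i \<in> {1..m}\<close>. Only the values of \<open>a i\<close> on the cube matter.
\<close>

definition boundary_representation ::
  "(real^'n) set \<Rightarrow> nat \<Rightarrow> (nat \<Rightarrow> real^'n \<Rightarrow> (real^'m) \<times> real) \<Rightarrow> (nat \<Rightarrow> real^'m \<Rightarrow> real)
     \<Rightarrow> real \<Rightarrow> real \<Rightarrow> real \<Rightarrow> bool" where
  "boundary_representation \<Omega> m T a \<delta> A \<beta> \<longleftrightarrow>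
     \<delta> > 0 \<and> A > 0 \<and> 0 < \<beta> \<and> \<beta> < 1 \<and>
     (\<forall>i\<in>{1..m}. coordinate_system (T i) \<and> A-lipschitz_on (cube \<delta>) (a i)) \<and>
     (\<forall>p\<in>frontier \<Omega>. \<exists>i\<in>{1..m}. on_graph \<delta> (T i) (a i) p) \<and>
     (\<forall>i\<in>{1..m}.
        graph_nbhd \<delta> \<beta> (T i) (a i) \<inter> \<Omega> =
          {p. fst (T i p) \<in> cube \<delta> \<and>
              a i (fst (T i p)) - \<beta> < snd (T i p) \<and> snd (T i p) < a i (fst (T i p))} \<and>
        graph_nbhd \<delta> \<beta> (T i) (a i) \<inter> frontier \<Omega> = {p. on_graph \<delta> (T i) (a i) p} \<and>
        (\<forall>p \<in> graph_nbhd \<delta> \<beta> (T i) (a i) \<inter> \<Omega>.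
           (a i (fst (T i p)) - snd (T i p)) / (1 + A) \<le> bdist \<Omega> p \<and>
           bdist \<Omega> p \<le> a i (fst (T i p)) - snd (T i p)))"

text \<open>
  The index \<open>i\<close> is associated with \<open>x\<close> if a projection of \<open>x\<close> onto the boundary lies on the
  \<open>i\<close>-th graph. Projection and index need not be unique.
\<close>

definition projection_index ::
  "(real^'n) set \<Rightarrow> nat \<Rightarrow> (nat \<Rightarrow> real^'n \<Rightarrow> (real^'m) \<times> real) \<Rightarrow> (nat \<Rightarrow> real^'m \<Rightarrow> real)
     \<Rightarrow> real \<Rightarrow> real^'n \<Rightarrow> nat \<Rightarrow> bool" where
  "projection_index \<Omega> m T a \<delta> x i \<longleftrightarrow>
     i \<in> {1..m} \<and>
     (\<exists>z\<in>frontier \<Omega>. dist z x = bdist \<Omega> x \<and> on_graph \<delta> (T i) (a i) z)"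

text \<open>
  The ``ball'' with centre \<open>x\<close> and radius \<open>r\<close>, for the coordinates \<open>T\<close> and the function \<open>a\<close>. The condition
  \<open>fst (T y) \<in> cube \<delta>\<close> makes explicit that \<open>a\<close> is only defined on the cube.
\<close>

definition gen_ball ::
  "(real^'n) set \<Rightarrow> real \<Rightarrow> real \<Rightarrow> (real^'n \<Rightarrow> (real^'m) \<times> real) \<Rightarrow> (real^'m \<Rightarrow> real)
     \<Rightarrow> real^'n \<Rightarrow> real \<Rightarrow> (real^'n) set" where
  "gen_ball \<Omega> \<gamma> \<delta> T a x r =
     (if bdist \<Omega> x \<ge> \<gamma> * r then ball x r
      else {y. fst (T y) \<in> cube \<delta> \<and> norm (fst (T y) - fst (T x)) \<le> r \<and>
               a (fst (T y)) - r - bdist \<Omega> x < snd (T y) \<and>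
               snd (T y) < a (fst (T y)) + r - bdist \<Omega> x})"

text \<open>
  \<open>f\<close> is \<open>C\<^sup>1\<close> up to the closure of \<open>S\<close>, and \<open>g\<close> is its gradient, extended continuously to the
  closure.
\<close>

definition C1_closure ::
  "(real^'n) set \<Rightarrow> (real^'n \<Rightarrow> real) \<Rightarrow> (real^'n \<Rightarrow> real^'n) \<Rightarrow> bool" where
  "C1_closure S f g \<longleftrightarrow>
     continuous_on (closure S) f \<and> continuous_on (closure S) g \<and>
     (\<forall>y\<in>interior S. GDERIV f y :> g y)"

end

theory Submission
  imports Defs
begin

text \<open>
  For an auxiliary set \<open>E \<subseteq> D\<close> the infimum is at most the mean over \<open>q \<in> E\<close> of
  \<open>\<integral>\<^sub>D w(p) |f(p) - f(q)|\<^sup>2 dp\<close>. Bounding the difference by the gradient along the segment from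
  \<open>q\<close> to \<open>p\<close> and exchanging integrals, it suffices to estimate, for every fixed \<open>s \<in> (0, 1)\<close>, the double integral
  of \<open>w(p) |\<nabla>f(u)|\<^sup>2\<close> with \<open>u = q + s(p - q)\<close>. Where \<open>w(p)\<close> is bounded by a multiple of \<open>w(u)\<close>, substitute
  \<open>u\<close> for \<open>p\<close> if \<open>s \<ge> 1/2\<close> and for \<open>q\<close> otherwise.

  On an interior ball \<open>d\<^sup>\<alpha>\<close> is comparable to a constant, and the bound of \<open>|p|\<^sup>\<lambda>\<close> by \<open>|u|\<^sup>\<lambda>\<close> fails only for
  \<open>3|p| < |u|\<close>. But then \<open>|u| \<le> 3(1 - s)r\<close>, which compensates the Jacobian \<open>(1 - s)\<^sup>-\<^sup>N\<close> of the
  substitution of \<open>u\<close> for \<open>q\<close>.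

  Near the boundary \<open>|y|\<^sup>\<lambda>\<close> is comparable to a constant, and straightening the graph turns the ball into a convex
  cylinder \<open>K \<times> (t\<^sub>0, t\<^sub>1)\<close> with a weight comparable to \<open>t\<^sup>\<alpha>\<close>. With \<open>E\<close> the upper half of the
  cylinder, \<open>t(u) \<ge> t(p)/2\<close>. The graph being only Lipschitz, the gradient bound is proved along
  Lipschitz curves. Only convexity of \<open>K\<close> matters, so it may be a thin piece of the cube.
\<close>

section \<open>Affine changes of variables and isometries for Lebesgue measure\<close>

lemma nn_integral_lborel_affine:
  fixes t :: "'a::euclidean_space"
  assumes [measurable]: "h \<in> borel_measurable borel" and c: "c \<noteq> 0"
  shows "(\<integral>\<^sup>+x. h x \<partial>lborel) = ennreal (\<bar>c\<bar> ^ DIM('a)) * (\<integral>\<^sup>+x. h (t + c *\<^sub>R x) \<partial>lborel)"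
  by (subst lborel_affine[OF c, of t])
     (simp add: nn_integral_density nn_integral_distr nn_integral_cmult)

text \<open>After subtracting \<open>J 0\<close> the map preserves norms and distances, hence inner
  products by polarization. The squared norm of its additivity defect then expands exactly as that
  of \<open>(x + z) - x - z\<close>, which is zero.\<close>

lemma isometry_affine:
  fixes J :: "'b::real_inner \<Rightarrow> 'a::real_inner"
  assumes iso: "\<And>x y. dist (J x) (J y) = dist x y"
  shows "J (x + z) = J x + (J z - J 0)"
proof -
  define f where "f x = J x - J 0" for x
  have f_dist: "norm (f x - f y) = norm (x - y)" for x y
    using iso[of x y] by (simp add: f_def dist_norm)
  have f_norm: "norm (f x) = norm x" for x
    using iso[of x 0] by (simp add: f_def dist_norm)
  have f_inner: "f x \<bullet> f y = x \<bullet> y" for x y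
    by (simp only: dot_norm_neg f_dist f_norm)
  have "(f (x + z) - f x - f z) \<bullet> (f (x + z) - f x - f z) = 0"
    by (simp add: inner_diff_left inner_diff_right f_inner inner_add_left inner_add_right)
  then have "f (x + z) - f x - f z = 0" by (simp only: inner_eq_zero_iff)
  then show ?thesis by (simp add: f_def algebra_simps)
qed

text \<open>The proof of the uniqueness of Haar measure: the measures of a set \<open>A\<close> and of its preimage are
  compared through the convolution with the indicator of the unit ball, whose preimage is a unit ball.\<close>

lemma distr_lborel_isometry:
  fixes J :: "'b::euclidean_space \<Rightarrow> 'a::euclidean_space"
  assumes iso: "\<And>x y. dist (J x) (J y) = dist x y" and "surj J" and dim: "DIM('b) = DIM('a)"
  shows "distr lborel borel J = lborel"
proof (rule measure_eqI)
  fix A assume "A \<in> sets (distr lborel borel J)"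
  then have [measurable]: "A \<in> sets borel" by simp
  have "continuous_on UNIV J"
    by (rule lipschitz_on_continuous_on[of 1]) (auto simp: lipschitz_on_def iso)
  then have [measurable]: "J \<in> borel_measurable borel"
    by (rule borel_measurable_continuous_onI)
  obtain z0 where z0: "J z0 = 0" using \<open>surj J\<close> by (metis surjD)
  have "\<exists>z. J z - J 0 = y" for y using \<open>surj J\<close> by (metis add_diff_cancel_right' surjD)
  then obtain Z where Z: "J (x + Z y) = J x + y" for x y
    using isometry_affine[of J, OF iso] by metis
  have J_norm: "norm (J x) < 1 \<longleftrightarrow> x \<in> ball z0 1" for x
    using iso[of z0 x] by (simp add: z0)
  have [measurable]: "ball (0::'a) 1 \<in> sets borel" "ball z0 1 \<in> sets borel" by simp_all
  let ?v = "emeasure lborel (ball (0::'a) 1)"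
  \<comment> \<open>Equality of the dimensions enters here: it gives the unit balls of both spaces
    the same volume.\<close>
  have v: "?v = emeasure lborel (ball z0 1)"
    using dim by (simp add: emeasure_ball)
  have v0: "?v \<noteq> 0" "?v \<noteq> \<infinity>"
    using unit_ball_vol_pos[of "real DIM('a)"] by (simp_all add: emeasure_ball del: unit_ball_vol_pos)
  \<comment> \<open>Integrating \<open>?k\<close> over \<open>y\<close> first gives the measure of
    the preimage of \<open>A\<close> times \<open>?v\<close>. Integrating over \<open>x\<close>
    first, after the shift by \<open>Z y\<close>, turns the condition on \<open>y - J x\<close> into
    \<open>x \<in> ball z0 1\<close> and moves the shift into \<open>A\<close>; a second exchange
    then yields the measure of \<open>A\<close> times \<open>?v\<close>.\<close>
  let ?k = "\<lambda>x y. indicator A (J x) * indicator (ball 0 1) (y - J x) :: ennreal"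
  have shift: "(\<integral>\<^sup>+y. indicator B (y - t) \<partial>lborel) = emeasure lborel B"
    if [measurable]: "B \<in> sets borel" for B and t :: 'a
    using nn_integral_lborel_affine[of "indicator B" 1 "- t"] by (simp add: add.commute)
  have "emeasure (distr lborel borel J) A * ?v = (\<integral>\<^sup>+x. indicator A (J x) \<partial>lborel) * ?v"
    using nn_integral_distr[of J lborel borel "indicator A :: 'a \<Rightarrow> ennreal"] by simp
  also have "\<dots> = (\<integral>\<^sup>+x. (\<integral>\<^sup>+y. ?k x y \<partial>lborel) \<partial>lborel)"
  proof -
    have "(\<integral>\<^sup>+y. ?k x y \<partial>lborel) = indicator A (J x) * ?v" for x
      by (subst nn_integral_cmult, measurable) (subst shift, auto)
    then show ?thesis by (simp add: nn_integral_multc)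
  qed
  also have "\<dots> = (\<integral>\<^sup>+y. (\<integral>\<^sup>+x. ?k x y \<partial>lborel) \<partial>lborel)"
    by (rule lborel_pair.Fubini') measurable
  also have "\<dots> = (\<integral>\<^sup>+y. (\<integral>\<^sup>+x. indicator A (J x + y) * indicator (ball z0 1) x \<partial>lborel) \<partial>lborel)"
  proof (rule nn_integral_cong)
    fix y :: 'a
    have "(\<integral>\<^sup>+x. ?k x y \<partial>lborel) = (\<integral>\<^sup>+x. ?k (Z y + 1 *\<^sub>R x) y \<partial>lborel)"
      by (subst nn_integral_lborel_affine[of "\<lambda>x. ?k x y" 1 "Z y"]) auto
    also have "\<dots> = (\<integral>\<^sup>+x. indicator A (J x + y) * indicator (ball z0 1) x \<partial>lborel)"
      by (intro nn_integral_cong) (auto simp: Z add.commute[of "Z y"] J_norm[symmetric] simp del: mem_ball split: split_indicator)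
    finally show "(\<integral>\<^sup>+x. ?k x y \<partial>lborel) = (\<integral>\<^sup>+x. indicator A (J x + y) * indicator (ball z0 1) x \<partial>lborel)" .
  qed
  also have "\<dots> = (\<integral>\<^sup>+x. (\<integral>\<^sup>+y. indicator A (J x + y) * indicator (ball z0 1) x \<partial>lborel) \<partial>lborel)"
    by (rule lborel_pair.Fubini') measurable
  also have "\<dots> = emeasure lborel A * ?v"
    using shift[of A "- J _"] by (simp add: nn_integral_multc nn_integral_cmult v add.commute)
  finally show "emeasure (distr lborel borel J) A = emeasure lborel A"
    using v0 ennreal_mult_cancel_left[of ?v "emeasure (distr lborel borel J) A" "emeasure lborel A"]
    by (simp add: mult.commute)
qed simp

section \<open>Averaging over pairs of points and integrating along segments\<close>

text \<open>The point of the segment depends on \<open>p\<close> with ratio \<open>s\<close> and on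
  \<open>q\<close> with ratio \<open>1 - s\<close>. One of the ratios is at least 1/2, so
  substituting for that variable costs at most \<open>2 ^ DIM('a)\<close>, and the other variable
  contributes the measure of \<open>D\<close>. A weight can be included in \<open>h\<close> once it
  has been moved to the point of the segment.\<close>

lemma nn_integral_segment_le:
  fixes D E :: "'a::euclidean_space set"
  assumes [measurable]: "D \<in> sets borel" "E \<in> sets borel" "h \<in> borel_measurable borel"
    and "convex D" "E \<subseteq> D" and s: "0 < s" "s < 1"
  shows "(\<integral>\<^sup>+q\<in>E. (\<integral>\<^sup>+p\<in>D. h (q + s *\<^sub>R (p - q)) \<partial>lborel) \<partial>lborel)
    \<le> 2 ^ DIM('a) * emeasure lborel D * (\<integral>\<^sup>+u\<in>D. h u \<partial>lborel)"
proof -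
  \<comment> \<open>The cutoff is harmless by convexity of \<open>D\<close>, and it lets the
    substituted variable range over the whole space without enlarging the final integral beyond
    \<open>D\<close>.\<close>
  define h' where "h' u = h u * indicator D u" for u
  have [measurable]: "h' \<in> borel_measurable borel" unfolding h'_def by measurable
  have scale: "(\<integral>\<^sup>+x. h' (t + c *\<^sub>R x) \<partial>lborel) \<le> 2 ^ DIM('a) * (\<integral>\<^sup>+u. h' u \<partial>lborel)"
    if "1/2 \<le> c" for c t
  proof -
    have "1 \<le> 2 ^ DIM('a) * \<bar>c\<bar> ^ DIM('a)"
      using that one_le_power[of "2 * \<bar>c\<bar>" "DIM('a)"] by (simp add: power_mult_distrib)
    then have "1 \<le> ennreal (2 ^ DIM('a) * \<bar>c\<bar> ^ DIM('a))" by (simp add: ennreal_ge_1)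
    also have "\<dots> = 2 ^ DIM('a) * ennreal (\<bar>c\<bar> ^ DIM('a))"
      by (subst ennreal_mult) (simp_all flip: ennreal_power)
    finally have "1 * (\<integral>\<^sup>+x. h' (t + c *\<^sub>R x) \<partial>lborel)
        \<le> 2 ^ DIM('a) * ennreal (\<bar>c\<bar> ^ DIM('a)) * (\<integral>\<^sup>+x. h' (t + c *\<^sub>R x) \<partial>lborel)"
      by (rule mult_right_mono) simp
    then show ?thesis
      using that by (subst nn_integral_lborel_affine[of h' c t]) (auto simp: mult.assoc)
  qed
  have in_D: "q + s *\<^sub>R (p - q) \<in> D" if "p \<in> D" "q \<in> E" for p q
    using convexD[OF \<open>convex D\<close>, of q p "1-s" s] that s \<open>E \<subseteq> D\<close> by (auto simp: algebra_simps)
  define I where "I = (\<integral>\<^sup>+u. h' u \<partial>lborel)"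
  have "(\<integral>\<^sup>+q\<in>E. (\<integral>\<^sup>+p\<in>D. h (q + s *\<^sub>R (p - q)) \<partial>lborel) \<partial>lborel)
     = (\<integral>\<^sup>+q. (\<integral>\<^sup>+p. h' (q + s *\<^sub>R (p - q)) * indicator E q * indicator D p \<partial>lborel) \<partial>lborel)"
    by (subst nn_integral_multc[symmetric])
       (auto intro!: nn_integral_cong simp: h'_def in_D split: split_indicator)
  also have "\<dots> \<le> 2 ^ DIM('a) * emeasure lborel D * I"
  proof (cases "1/2 \<le> s")
    case True
    have "(\<integral>\<^sup>+p. h' (q + s *\<^sub>R (p - q)) * indicator E q * indicator D p \<partial>lborel)
      \<le> 2 ^ DIM('a) * I * indicator D q" for q
    proof (cases "q \<in> E")
      case True
      have "(\<integral>\<^sup>+p. h' (q + s *\<^sub>R (p - q)) * indicator E q * indicator D p \<partial>lborel)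
        \<le> (\<integral>\<^sup>+p. h' ((q - s *\<^sub>R q) + s *\<^sub>R p) \<partial>lborel)"
        by (intro nn_integral_mono) (auto simp: algebra_simps split: split_indicator)
      then show ?thesis using scale[OF \<open>1/2 \<le> s\<close>, of "q - s *\<^sub>R q"] True \<open>E \<subseteq> D\<close>
        unfolding I_def by (auto split: split_indicator)
    qed simp
    then have "(\<integral>\<^sup>+q. (\<integral>\<^sup>+p. h' (q + s *\<^sub>R (p - q)) * indicator E q * indicator D p \<partial>lborel) \<partial>lborel)
      \<le> (\<integral>\<^sup>+q. 2 ^ DIM('a) * I * indicator D q \<partial>lborel)"
      by (intro nn_integral_mono)
    also have "\<dots> = 2 ^ DIM('a) * emeasure lborel D * I"
      by (subst nn_integral_cmult_indicator) (simp_all add: mult_ac)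
    finally show ?thesis .
  next
    case False
    have "(\<integral>\<^sup>+q. h' (q + s *\<^sub>R (p - q)) * indicator E q * indicator D p \<partial>lborel)
      \<le> 2 ^ DIM('a) * I * indicator D p" for p
    proof (cases "p \<in> D")
      case True
      have "(\<integral>\<^sup>+q. h' (q + s *\<^sub>R (p - q)) * indicator E q * indicator D p \<partial>lborel)
        \<le> (\<integral>\<^sup>+q. h' (s *\<^sub>R p + (1 - s) *\<^sub>R q) \<partial>lborel)"
        by (intro nn_integral_mono) (auto simp: algebra_simps split: split_indicator)
      then show ?thesis using scale[of "1-s" "s *\<^sub>R p"] True False
        unfolding I_def by (auto split: split_indicator)
    qed simp
    then have "(\<integral>\<^sup>+p. (\<integral>\<^sup>+q. h' (q + s *\<^sub>R (p - q)) * indicator E q * indicator D p \<partial>lborel) \<partial>lborel)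
      \<le> (\<integral>\<^sup>+p. 2 ^ DIM('a) * I * indicator D p \<partial>lborel)"
      by (intro nn_integral_mono)
    also have "\<dots> = 2 ^ DIM('a) * emeasure lborel D * I"
      by (subst nn_integral_cmult_indicator) (simp_all add: mult_ac)
    finally show ?thesis
      by (subst lborel_pair.Fubini') measurable
  qed
  finally show ?thesis unfolding I_def h'_def .
qed

text \<open>Each value \<open>F q\<close> with \<open>q \<in> E\<close> is a competitor for the
  infimum, so integrating over \<open>E\<close> bounds the infimum times the measure of
  \<open>E\<close> by a triple integral. The measure of \<open>E\<close> reappears on the right
  through \<open>kern\<close> and cancels, being positive and finite.\<close>

lemma infimum_le_segment_energy:
  fixes D E :: "'a::euclidean_space set"
  assumes [measurable]: "D \<in> sets borel" "E \<in> sets borel"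
    and [measurable]: "w \<in> borel_measurable borel" "H \<in> borel_measurable borel" "F \<in> borel_measurable borel"
    and grad: "\<And>p q. p \<in> D \<Longrightarrow> q \<in> E \<Longrightarrow>
      ennreal (\<bar>F p - F q\<bar>\<^sup>2) \<le> k * (\<integral>\<^sup>+s\<in>{0<..<1}. H (q + s *\<^sub>R (p - q)) \<partial>lborel)"
    and kern: "\<And>s. 0 < s \<Longrightarrow> s < 1 \<Longrightarrow>
      (\<integral>\<^sup>+q\<in>E. (\<integral>\<^sup>+p\<in>D. w p * H (q + s *\<^sub>R (p - q)) \<partial>lborel) \<partial>lborel) \<le> Z * emeasure lborel E"
    and E: "emeasure lborel E \<noteq> 0" "emeasure lborel E \<noteq> \<infinity>"
  shows "(INF \<xi>\<in>(UNIV :: real set). \<integral>\<^sup>+p\<in>D. w p * ennreal (\<bar>F p - \<xi>\<bar>\<^sup>2) \<partial>lborel) \<le> k * Z"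
    (is "?X \<le> _")
proof -
  let ?J = "\<lambda>p q s. w p * H (q + s *\<^sub>R (p - q)) * indicator D p * indicator E q * indicator {0<..<1} s"
  have "?X * emeasure lborel E = (\<integral>\<^sup>+q\<in>E. ?X \<partial>lborel)"
    by (simp add: nn_integral_cmult_indicator)
  also have "\<dots> \<le> (\<integral>\<^sup>+q. k * (\<integral>\<^sup>+p. (\<integral>\<^sup>+s. ?J p q s \<partial>lborel) \<partial>lborel) \<partial>lborel)"
  proof (rule nn_integral_mono)
    fix q :: 'a
    show "?X * indicator E q \<le> k * (\<integral>\<^sup>+p. (\<integral>\<^sup>+s. ?J p q s \<partial>lborel) \<partial>lborel)"
    proof (cases "q \<in> E")
      case True
      have "?X \<le> (\<integral>\<^sup>+p\<in>D. w p * ennreal (\<bar>F p - F q\<bar>\<^sup>2) \<partial>lborel)"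
        by (rule INF_lower) simp
      also have "\<dots> \<le> (\<integral>\<^sup>+p. k * (\<integral>\<^sup>+s. ?J p q s \<partial>lborel) \<partial>lborel)"
      proof (rule nn_integral_mono)
        fix p :: 'a
        show "w p * ennreal (\<bar>F p - F q\<bar>\<^sup>2) * indicator D p \<le> k * (\<integral>\<^sup>+s. ?J p q s \<partial>lborel)"
        proof (cases "p \<in> D")
          case p: True
          have "(\<integral>\<^sup>+s. ?J p q s \<partial>lborel) = w p * (\<integral>\<^sup>+s\<in>{0<..<1}. H (q + s *\<^sub>R (p - q)) \<partial>lborel)"
            using p True by (subst nn_integral_cmult[symmetric]) (auto simp: mult_ac)
          then show ?thesis
            using mult_left_mono[OF grad[OF p True], of "w p"] p by (simp add: mult_ac)
        qed simp
      qed
      also have "\<dots> = k * (\<integral>\<^sup>+p. (\<integral>\<^sup>+s. ?J p q s \<partial>lborel) \<partial>lborel)"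
        by (rule nn_integral_cmult) measurable
      finally show ?thesis using True by simp
    qed simp
  qed
  also have "\<dots> = k * (\<integral>\<^sup>+q. (\<integral>\<^sup>+p. (\<integral>\<^sup>+s. ?J p q s \<partial>lborel) \<partial>lborel) \<partial>lborel)"
    by (rule nn_integral_cmult) measurable
  \<comment> \<open>Two exchanges make \<open>s\<close> the outermost variable, because
    \<open>kern\<close> estimates the double integral for fixed \<open>s\<close>. The interval of
    the \<open>s\<close> has length one and adds no constant.\<close>
  also have "(\<integral>\<^sup>+q. (\<integral>\<^sup>+p. (\<integral>\<^sup>+s. ?J p q s \<partial>lborel) \<partial>lborel) \<partial>lborel)
      = (\<integral>\<^sup>+q. (\<integral>\<^sup>+s. (\<integral>\<^sup>+p. ?J p q s \<partial>lborel) \<partial>lborel) \<partial>lborel)"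
    by (intro nn_integral_cong lborel_pair.Fubini') measurable
  also have "\<dots> = (\<integral>\<^sup>+s. (\<integral>\<^sup>+q. (\<integral>\<^sup>+p. ?J p q s \<partial>lborel) \<partial>lborel) \<partial>lborel)"
    by (rule lborel_pair.Fubini') measurable
  also have "\<dots> \<le> (\<integral>\<^sup>+s. Z * emeasure lborel E * indicator {0<..<1::real} s \<partial>lborel)"
  proof (rule nn_integral_mono)
    fix s :: real
    show "(\<integral>\<^sup>+q. (\<integral>\<^sup>+p. ?J p q s \<partial>lborel) \<partial>lborel) \<le> Z * emeasure lborel E * indicator {0<..<1::real} s"
    proof (cases "s \<in> {0<..<1}")
      case True
      have "(\<integral>\<^sup>+q. (\<integral>\<^sup>+p. ?J p q s \<partial>lborel) \<partial>lborel) =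
        (\<integral>\<^sup>+q\<in>E. (\<integral>\<^sup>+p\<in>D. w p * H (q + s *\<^sub>R (p - q)) \<partial>lborel) \<partial>lborel)"
        using True by (subst nn_integral_multc[symmetric]) (auto intro!: nn_integral_cong simp: mult_ac)
      then show ?thesis using kern[of s] True by simp
    qed simp
  qed
  also have "\<dots> = Z * emeasure lborel E"
    by (simp add: nn_integral_cmult_indicator)
  finally have "?X * emeasure lborel E \<le> k * Z * emeasure lborel E"
    by (simp add: mult.assoc mult_left_mono)
  then show ?thesis
    using E ennreal_mult_le_mult_iff[of "emeasure lborel E" ?X "k * Z"] by (simp add: mult.commute)
qed

section \<open>The power weight near the origin\<close>

lemma nn_integral_norm_powr_ball:
  fixes lam :: real
  assumes "0 < \<rho>"
  shows "(\<integral>\<^sup>+p\<in>ball 0 \<rho>. ennreal (norm (p::'a::euclidean_space) powr lam) \<partial>lborel)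
    = ennreal (\<rho> powr (real DIM('a) + lam)) * (\<integral>\<^sup>+p\<in>ball 0 1. ennreal (norm (p::'a) powr lam) \<partial>lborel)"
proof -
  have [measurable]: "ball (0::'a) \<rho> \<in> sets borel" "ball (0::'a) 1 \<in> sets borel" by simp_all
  have "(\<integral>\<^sup>+p\<in>ball 0 \<rho>. ennreal (norm (p::'a) powr lam) \<partial>lborel) = ennreal (\<bar>\<rho>\<bar> ^ DIM('a)) *
     (\<integral>\<^sup>+p. ennreal (norm (0 + \<rho> *\<^sub>R p::'a) powr lam) * indicator (ball 0 \<rho>) (0 + \<rho> *\<^sub>R p) \<partial>lborel)"
    by (rule nn_integral_lborel_affine, measurable) (use assms in simp)
  also have "(\<integral>\<^sup>+p. ennreal (norm (0 + \<rho> *\<^sub>R p::'a) powr lam) * indicator (ball 0 \<rho>) (0 + \<rho> *\<^sub>R p) \<partial>lborel)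
    = (\<integral>\<^sup>+p. ennreal (\<rho> powr lam) * (ennreal (norm (p::'a) powr lam) * indicator (ball 0 1) p) \<partial>lborel)"
    using assms by (intro nn_integral_cong)
      (auto simp: powr_mult ennreal_mult split: split_indicator)
  also have "\<dots> = ennreal (\<rho> powr lam) * (\<integral>\<^sup>+p\<in>ball 0 1. ennreal (norm (p::'a) powr lam) \<partial>lborel)"
    by (rule nn_integral_cmult) measurable
  finally show ?thesis
    using assms by (simp add: powr_add powr_realpow ennreal_mult mult.assoc)
qed

text \<open>A dyadic decomposition dominates the weight by a series of multiples of indicators of
  balls. The integrals of its terms form a geometric series with ratio \<open>q\<close>, which is
  below one exactly because \<open>lam\<close> exceeds minus the dimension.\<close>

lemma nn_integral_norm_powr_unit_ball_finite:
  assumes "- real DIM('a) < lam" "lam \<le> 0"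
  shows "(\<integral>\<^sup>+p\<in>ball 0 1. ennreal (norm (p::'a::euclidean_space) powr lam) \<partial>lborel) < \<infinity>"
proof -
  define v where "v = unit_ball_vol (real DIM('a))"
  have v: "0 \<le> v" unfolding v_def by simp
  \<comment> \<open>A point of the shell between the radii \<open>(1/2) ^ Suc k\<close> and
    \<open>(1/2) ^ k\<close> has weight at most \<open>c k\<close>, the value at the inner radius,
    since \<open>lam \<le> 0\<close>. The series uses the whole ball of the outer radius in place of
    the shell.\<close>
  define c where "c k = ((1/2) ^ Suc k) powr lam" for k :: nat
  define q where "q = (1/2) powr (lam + real DIM('a))"
  have "q = 2 powr (- (lam + real DIM('a)))"
    unfolding q_def by (simp add: powr_divide powr_minus_divide[symmetric])
  then have q: "0 < q" "q < 1"
    using assms powr_less_mono[of "- (lam + real DIM('a))" 0 2] by auto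
  have [measurable]: "ball (0::'a) ((1/2) ^ k) \<in> sets borel" for k by simp
  have term_le: "X k \<le> (\<Sum>k. X k)" for X :: "nat \<Rightarrow> ennreal" and k
    using sum_le_suminf[of X "{k}"] by simp
  have "(\<integral>\<^sup>+p\<in>ball 0 1. ennreal (norm (p::'a) powr lam) \<partial>lborel)
     \<le> (\<integral>\<^sup>+p. (\<Sum>k. ennreal (c k) * indicator (ball (0::'a) ((1/2)^k)) p) \<partial>lborel)"
  proof (rule nn_integral_mono)
    fix p :: 'a
    show "ennreal (norm p powr lam) * indicator (ball 0 1) p \<le> (\<Sum>k. ennreal (c k) * indicator (ball 0 ((1/2)^k)) p)"
    \<comment> \<open>At the origin the left side vanishes because
      \<open>0 powr lam = 0\<close>.\<close>
    proof (cases "p \<noteq> 0 \<and> norm p < 1")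
      case True
      define n where "n = (LEAST n. (1/2::real) ^ n \<le> norm p)"
      have "\<exists>n. (1/2::real) ^ n \<le> norm p"
        using real_arch_pow_inv[of "norm p" "1/2"] True by (auto intro: less_imp_le)
      then have n: "(1/2::real) ^ n \<le> norm p" unfolding n_def by (rule LeastI_ex)
      then have "n \<noteq> 0" using True by (intro notI) simp
      then obtain k where k: "n = Suc k" by (cases n) auto
      have "norm p < (1/2) ^ k"
        using not_less_Least[of k "\<lambda>n. (1/2::real) ^ n \<le> norm p"] k unfolding n_def[symmetric] by simp
      moreover have "norm p powr lam \<le> c k"
        unfolding c_def using n k assms by (intro powr_mono2') auto
      ultimately have "ennreal (norm p powr lam) * indicator (ball 0 1) p
          \<le> ennreal (c k) * indicator (ball 0 ((1/2)^k)) p"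
        using True by (auto intro: ennreal_leI)
      also have "\<dots> \<le> (\<Sum>k. ennreal (c k) * indicator (ball 0 ((1/2)^k)) p)"
        by (rule term_le)
      finally show ?thesis .
    qed (auto split: split_indicator)
  qed
  also have "\<dots> = (\<Sum>k. (\<integral>\<^sup>+p. ennreal (c k) * indicator (ball (0::'a) ((1/2)^k)) p \<partial>lborel))"
    by (rule nn_integral_suminf) measurable
  also have "\<dots> = (\<Sum>k. ennreal ((1/2) powr lam * v * q ^ k))"
  proof (rule arg_cong[where f=suminf], rule ext)
    fix k :: nat
    have "c k * (v * ((1/2)^k) ^ DIM('a)) = (1/2) powr lam * v * q ^ k"
      by (simp add: c_def q_def powr_add powr_mult powr_realpow[symmetric] powr_powr powr_divide
          power_mult[symmetric] field_simps)
    moreover have "ennreal (c k) * ennreal (v * ((1/2)^k) ^ DIM('a)) = ennreal (c k * (v * ((1/2)^k) ^ DIM('a)))"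
      using v by (intro ennreal_mult[symmetric]) (auto simp: c_def)
    moreover have "(\<integral>\<^sup>+p. ennreal (c k) * indicator (ball (0::'a) ((1/2)^k)) p \<partial>lborel)
      = ennreal (c k) * ennreal (v * ((1/2)^k) ^ DIM('a))"
      by (subst nn_integral_cmult_indicator) (auto simp: emeasure_ball v_def)
    ultimately show "(\<integral>\<^sup>+p. ennreal (c k) * indicator (ball (0::'a) ((1/2)^k)) p \<partial>lborel)
      = ennreal ((1/2) powr lam * v * q ^ k)" by (simp only:)
  qed
  also have "\<dots> < \<infinity>"
  proof -
    have "summable (\<lambda>k. (1/2) powr lam * v * q ^ k)"
      using q by (intro summable_mult summable_geometric) simp
    then show ?thesis using q v by (subst suminf_ennreal2) auto
  qed
  finally show ?thesis .
qed

text \<open>This is the region where the weight at \<open>p\<close> is not controlled by the weight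
  at the point \<open>u\<close> of the segment. For fixed \<open>u\<close>, the point
  \<open>p\<close> lies in a ball of radius \<open>norm u / 3\<close> about the origin, and the
  weight integrates there to a multiple of \<open>norm u powr (DIM('a) + lam)\<close>. One factor
  \<open>norm u powr lam\<close> is the desired weight; the remaining power of \<open>norm u\<close>
  pays for the Jacobian, as \<open>norm u\<close> is at most \<open>3 * (1 - s) * r\<close>.\<close>

lemma segment_kernel_far:
  fixes x :: "'a::euclidean_space"
  assumes [measurable]: "H \<in> borel_measurable borel"
    and s: "0 < s" "s < 1" and "0 < r" and lam: "- real DIM('a) < lam"
  shows "(\<integral>\<^sup>+q\<in>ball x r. (\<integral>\<^sup>+p\<in>ball x r. ennreal (norm p powr lam) * H (q + s *\<^sub>R (p - q))
        * indicator {p. 3 * norm p < norm (q + s *\<^sub>R (p - q))} p \<partial>lborel) \<partial>lborel)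
    \<le> ennreal ((3 * r) ^ DIM('a)) * (\<integral>\<^sup>+p\<in>ball 0 1. ennreal (norm (p::'a) powr lam) \<partial>lborel)
      * (\<integral>\<^sup>+u\<in>ball x r. ennreal (norm u powr lam) * H u \<partial>lborel)" (is "?A \<le> _ * ?J * ?I")
proof -
  define W where "W p = ennreal (norm p powr lam)" for p :: 'a
  have [measurable]: "W \<in> borel_measurable borel" unfolding W_def by measurable
  have [measurable]: "ball x r \<in> sets borel" by simp
  define \<phi> where "\<phi> p u = H u * indicator (ball x r) u * indicator {u. 3 * norm p < norm u} u
     * indicator {u. norm u \<le> 3 * (1 - s) * r} u" for p u :: 'a
  \<comment> \<open>Measurability is needed jointly in both variables, once with \<open>u\<close> as
    a free variable and once with \<open>u\<close> replaced by an affine expression in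
    \<open>p\<close> and \<open>q\<close>; this form under composition covers both.\<close>
  have [measurable]: "(\<lambda>z. \<phi> (f z) (g z)) \<in> borel_measurable M"
    if [measurable]: "f \<in> borel_measurable M" "g \<in> borel_measurable M"
    for f g and M :: "'b measure"
  proof -
    have "\<phi> (f z) (g z) = H (g z) * indicator (ball x r) (g z)
      * (if 3 * norm (f z) < norm (g z) then 1 else 0) * (if norm (g z) \<le> 3 * (1 - s) * r then 1 else 0)" for z
      by (auto simp: \<phi>_def)
    then show ?thesis by simp
  qed
  let ?N = "DIM('a)"
  have "?A \<le> (\<integral>\<^sup>+q. (\<integral>\<^sup>+p. W p * \<phi> p (s *\<^sub>R p + (1 - s) *\<^sub>R q) \<partial>lborel) \<partial>lborel)"
  proof (rule nn_integral_mono)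
    fix q :: 'a
    show "(\<integral>\<^sup>+p\<in>ball x r. ennreal (norm p powr lam) * H (q + s *\<^sub>R (p - q))
        * indicator {p. 3 * norm p < norm (q + s *\<^sub>R (p - q))} p \<partial>lborel) * indicator (ball x r) q
      \<le> (\<integral>\<^sup>+p. W p * \<phi> p (s *\<^sub>R p + (1 - s) *\<^sub>R q) \<partial>lborel)"
    proof (cases "q \<in> ball x r")
      case q: True
      have "ennreal (norm p powr lam) * H (q + s *\<^sub>R (p - q))
          * indicator {p. 3 * norm p < norm (q + s *\<^sub>R (p - q))} p * indicator (ball x r) p
        \<le> W p * \<phi> p (s *\<^sub>R p + (1 - s) *\<^sub>R q)" for p
      proof (cases "p \<in> ball x r \<and> 3 * norm p < norm (q + s *\<^sub>R (p - q))")
        case True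
        define u where "u = s *\<^sub>R p + (1 - s) *\<^sub>R q"
        have u: "q + s *\<^sub>R (p - q) = u" by (simp add: u_def algebra_simps)
        have "u \<in> ball x r"
          unfolding u_def using True q s convexD[OF convex_ball, of p x r q s "1-s"] by simp
        \<comment> \<open>The distance from \<open>u\<close> to \<open>p\<close> is at most
          \<open>2 * (1 - s) * r\<close>, while \<open>norm p\<close> is less than a third of
          \<open>norm u\<close>. Hence two thirds of \<open>norm u\<close> are at most
          \<open>2 * (1 - s) * r\<close>.\<close>
        moreover have "norm u \<le> 3 * (1 - s) * r"
        proof -
          have "u - p = (1 - s) *\<^sub>R (q - p)" by (simp add: u_def algebra_simps)
          then have "norm (u - p) = (1 - s) * norm (q - p)" using s by simp
          also have "norm (q - p) \<le> 2 * r"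
            using True q norm_triangle_ineq4[of "q - x" "p - x"] by (auto simp: dist_norm norm_minus_commute)
          finally have "norm (u - p) \<le> (1 - s) * (2 * r)" using s by (simp add: mult_left_mono)
          moreover have "norm u \<le> norm (u - p) + norm p" using norm_triangle_ineq[of "u - p" p] by simp
          ultimately show ?thesis using True unfolding u by (simp add: algebra_simps)
        qed
        ultimately show ?thesis
          using True unfolding u_def[symmetric] by (auto simp: \<phi>_def W_def u split: split_indicator)
      qed (auto split: split_indicator)
      then show ?thesis using q by (auto intro!: nn_integral_mono)
    qed simp
  qed
  also have "\<dots> = (\<integral>\<^sup>+p. (\<integral>\<^sup>+q. W p * \<phi> p (s *\<^sub>R p + (1 - s) *\<^sub>R q) \<partial>lborel) \<partial>lborel)"
    by (rule lborel_pair.Fubini') measurable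
  also have "\<dots> = (\<integral>\<^sup>+p. W p * (\<integral>\<^sup>+q. \<phi> p (s *\<^sub>R p + (1 - s) *\<^sub>R q) \<partial>lborel) \<partial>lborel)"
    by (simp add: nn_integral_cmult)
  \<comment> \<open>Both sides are multiplied by the Jacobian, so that the substitution absorbs it;
    the same factor emerges again from the bound on \<open>norm u\<close> and is cancelled at the
    end.\<close>
  finally have "ennreal ((1 - s) ^ ?N) * ?A \<le> ennreal ((1 - s) ^ ?N) * \<dots>"
    by (rule mult_left_mono) simp
  also have "\<dots> = (\<integral>\<^sup>+p. W p * (ennreal ((1 - s) ^ ?N) * (\<integral>\<^sup>+q. \<phi> p (s *\<^sub>R p + (1 - s) *\<^sub>R q) \<partial>lborel)) \<partial>lborel)"
    by (subst nn_integral_cmult[symmetric]) (auto simp: mult_ac)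
  also have "\<dots> = (\<integral>\<^sup>+p. W p * (\<integral>\<^sup>+u. \<phi> p u \<partial>lborel) \<partial>lborel)"
  proof (intro nn_integral_cong arg_cong2[where f="(*)"] refl)
    fix p :: 'a
    show "ennreal ((1 - s) ^ ?N) * (\<integral>\<^sup>+q. \<phi> p (s *\<^sub>R p + (1 - s) *\<^sub>R q) \<partial>lborel) = (\<integral>\<^sup>+u. \<phi> p u \<partial>lborel)"
      using s by (subst nn_integral_lborel_affine[of "\<phi> p" "1 - s" "s *\<^sub>R p"]) auto
  qed
  also have "\<dots> = (\<integral>\<^sup>+p. (\<integral>\<^sup>+u. W p * \<phi> p u \<partial>lborel) \<partial>lborel)"
    by (simp add: nn_integral_cmult)
  also have "\<dots> = (\<integral>\<^sup>+u. (\<integral>\<^sup>+p. W p * \<phi> p u \<partial>lborel) \<partial>lborel)"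
    by (rule lborel_pair.Fubini') measurable
  also have "\<dots> \<le> (\<integral>\<^sup>+u. ennreal ((1 - s) ^ ?N) * (ennreal ((3 * r) ^ ?N) * ?J) * (W u * H u * indicator (ball x r) u) \<partial>lborel)"
  proof (rule nn_integral_mono)
    fix u :: 'a
    have [measurable]: "ball (0::'a) (norm u / 3) \<in> sets borel" by simp
    let ?c = "H u * indicator (ball x r) u * indicator {u. norm u \<le> 3 * (1 - s) * r} u"
    have "(\<integral>\<^sup>+p. W p * \<phi> p u \<partial>lborel) = (\<integral>\<^sup>+p. (W p * indicator (ball 0 (norm u / 3)) p) * ?c \<partial>lborel)"
      by (intro nn_integral_cong) (auto simp: \<phi>_def split: split_indicator)
    also have "\<dots> = (\<integral>\<^sup>+p. W p * indicator (ball 0 (norm u / 3)) p \<partial>lborel) * ?c"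
      by (rule nn_integral_multc) measurable
    also have "\<dots> \<le> ennreal ((1 - s) ^ ?N) * (ennreal ((3 * r) ^ ?N) * ?J) * (W u * H u * indicator (ball x r) u)"
    proof (cases "u \<noteq> 0 \<and> norm u \<le> 3 * (1 - s) * r")
      case True
      have "(\<integral>\<^sup>+p. W p * indicator (ball 0 (norm u / 3)) p \<partial>lborel) = ennreal ((norm u / 3) powr (real ?N + lam)) * ?J"
        unfolding W_def using True by (intro nn_integral_norm_powr_ball) auto
      also have "\<dots> \<le> ennreal ((1 - s) ^ ?N * (3 * r) ^ ?N * (norm u powr lam)) * ?J"
      proof (intro mult_right_mono ennreal_leI)
        have "(norm u / 3) powr (real ?N + lam) \<le> norm u powr (real ?N + lam)"
          using lam by (intro powr_mono2) auto
        also have "\<dots> = norm u ^ ?N * norm u powr lam"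
          using True by (simp add: powr_add powr_realpow)
        also have "\<dots> \<le> (3 * (1 - s) * r) ^ ?N * norm u powr lam"
          using True by (intro mult_right_mono power_mono) auto
        finally show "(norm u / 3) powr (real ?N + lam) \<le> (1 - s) ^ ?N * (3 * r) ^ ?N * (norm u powr lam)"
          by (simp only: power_mult_distrib mult_ac)
      qed simp
      finally show ?thesis
        using True s \<open>0 < r\<close> by (auto simp: W_def ennreal_mult mult_ac intro!: mult_left_mono split: split_indicator)
    qed (auto split: split_indicator)
    finally show "(\<integral>\<^sup>+p. W p * \<phi> p u \<partial>lborel)
      \<le> ennreal ((1 - s) ^ ?N) * (ennreal ((3 * r) ^ ?N) * ?J) * (W u * H u * indicator (ball x r) u)" .
  qed
  also have "\<dots> = ennreal ((1 - s) ^ ?N) * (ennreal ((3 * r) ^ ?N) * ?J * ?I)"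
    by (subst nn_integral_cmult) (auto simp: W_def mult.assoc)
  finally show ?thesis
    using s by (subst (asm) ennreal_mult_le_mult_iff) auto
qed

text \<open>The double integral is split at \<open>3 * norm p < norm u\<close>, where
  \<open>u\<close> is the point of the segment. Off this region the weight moves from
  \<open>p\<close> to \<open>u\<close> and \<open>nn_integral_segment_le\<close> applies; on it
  \<open>segment_kernel_far\<close> does.\<close>

lemma segment_kernel_norm_powr:
  assumes lam: "- real DIM('a) < lam" "lam \<le> 0"
  obtains K where "0 < K"
    "\<And>(x :: 'a::euclidean_space) r s H. \<lbrakk>0 < r; 0 < s; s < 1; H \<in> borel_measurable borel\<rbrakk> \<Longrightarrow>
      (\<integral>\<^sup>+q\<in>ball x r. (\<integral>\<^sup>+p\<in>ball x r. ennreal (norm p powr lam) * H (q + s *\<^sub>R (p - q)) \<partial>lborel) \<partial>lborel)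
      \<le> ennreal K * emeasure lborel (ball x r) * (\<integral>\<^sup>+u\<in>ball x r. ennreal (norm u powr lam) * H u \<partial>lborel)"
proof -
  define J where "J = enn2real (\<integral>\<^sup>+p\<in>ball 0 1. ennreal (norm (p::'a) powr lam) \<partial>lborel)"
  have J: "(\<integral>\<^sup>+p\<in>ball 0 1. ennreal (norm (p::'a) powr lam) \<partial>lborel) = ennreal J" and "0 \<le> J"
    unfolding J_def using nn_integral_norm_powr_unit_ball_finite[OF lam] by (auto simp: ennreal_enn2real_if)
  let ?v = "unit_ball_vol (real DIM('a))" and ?N = "DIM('a)"
  have v: "0 < ?v" by simp
  \<comment> \<open>The first term is the cost of moving the weight times that of the substitution.
    The second is the constant \<open>(3 * r) ^ ?N * J\<close> of the far region, divided by the
    volume of the ball so that both carry the factor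
    \<open>emeasure lborel (ball x r)\<close>.\<close>
  define K where "K = 3 powr (- lam) * 2 ^ ?N + 3 ^ ?N * J / ?v"
  show ?thesis
  proof
    show "0 < K" unfolding K_def using v \<open>0 \<le> J\<close> by (intro add_pos_nonneg) auto
    fix x :: 'a and r s :: real and H :: "'a \<Rightarrow> ennreal"
    assume r: "0 < r" and s: "0 < s" "s < 1" and H[measurable]: "H \<in> borel_measurable borel"
    define W where "W p = ennreal (norm p powr lam)" for p :: 'a
    \<comment> \<open>The value \<open>0 powr lam = 0\<close> would spoil the comparison of the weights at the origin.\<close>
    define W0 where "W0 p = (if p = 0 then \<infinity> else W p)" for p :: 'a
    have [measurable]: "W \<in> borel_measurable borel" "W0 \<in> borel_measurable borel"
      unfolding W_def W0_def by measurable
    have [measurable]: "ball x r \<in> sets borel" by simp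
    let ?I = "\<integral>\<^sup>+u\<in>ball x r. W u * H u \<partial>lborel"
    let ?u = "\<lambda>p q. q + s *\<^sub>R (p - q)"
    have *: "W p * H (?u p q) \<le> ennreal (3 powr (- lam)) * (W0 (?u p q) * H (?u p q))
        + W p * H (?u p q) * indicator {p. 3 * norm p < norm (?u p q)} p" for p q
    proof (cases "3 * norm p < norm (?u p q)")
      case False
      have "W p \<le> ennreal (3 powr (- lam)) * W0 (?u p q)"
      proof (cases "?u p q = 0")
        case False
        then have "norm p powr lam \<le> (norm (?u p q) / 3) powr lam"
          using \<open>\<not> 3 * norm p < norm (?u p q)\<close> lam by (intro powr_mono2') auto
        also have "\<dots> = 3 powr (- lam) * norm (?u p q) powr lam"
          by (simp add: powr_divide powr_minus field_simps)
        finally show ?thesis using False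
          by (simp add: W0_def W_def ennreal_mult[symmetric] ennreal_leI)
      qed (simp add: W0_def ennreal_mult_top)
      then have "W p * H (?u p q) \<le> ennreal (3 powr (- lam)) * W0 (?u p q) * H (?u p q)"
        by (rule mult_right_mono) simp
      then show ?thesis using False by (simp add: mult.assoc)
    qed simp
    have "(\<integral>\<^sup>+q\<in>ball x r. (\<integral>\<^sup>+p\<in>ball x r. W p * H (?u p q) \<partial>lborel) \<partial>lborel)
      \<le> (\<integral>\<^sup>+q. (\<integral>\<^sup>+p\<in>ball x r. ennreal (3 powr (- lam)) * (W0 (?u p q) * H (?u p q)) \<partial>lborel) * indicator (ball x r) q
         + (\<integral>\<^sup>+p\<in>ball x r. W p * H (?u p q) * indicator {p. 3 * norm p < norm (?u p q)} p \<partial>lborel) * indicator (ball x r) q \<partial>lborel)"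
    proof (rule nn_integral_mono)
      fix q :: 'a
      have "(\<integral>\<^sup>+p\<in>ball x r. W p * H (?u p q) \<partial>lborel) \<le>
        (\<integral>\<^sup>+p. ennreal (3 powr (- lam)) * (W0 (?u p q) * H (?u p q)) * indicator (ball x r) p
          + W p * H (?u p q) * indicator {p. 3 * norm p < norm (?u p q)} p * indicator (ball x r) p \<partial>lborel)"
        using * by (intro nn_integral_mono) (auto split: split_indicator)
      also have "\<dots> = (\<integral>\<^sup>+p\<in>ball x r. ennreal (3 powr (- lam)) * (W0 (?u p q) * H (?u p q)) \<partial>lborel)
         + (\<integral>\<^sup>+p\<in>ball x r. W p * H (?u p q) * indicator {p. 3 * norm p < norm (?u p q)} p \<partial>lborel)"
        by (rule nn_integral_add) measurable
      finally show "(\<integral>\<^sup>+p\<in>ball x r. W p * H (?u p q) \<partial>lborel) * indicator (ball x r) q \<le>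
        (\<integral>\<^sup>+p\<in>ball x r. ennreal (3 powr (- lam)) * (W0 (?u p q) * H (?u p q)) \<partial>lborel) * indicator (ball x r) q
         + (\<integral>\<^sup>+p\<in>ball x r. W p * H (?u p q) * indicator {p. 3 * norm p < norm (?u p q)} p \<partial>lborel) * indicator (ball x r) q"
        by (auto split: split_indicator)
    qed
    also have "\<dots> = (\<integral>\<^sup>+q\<in>ball x r. (\<integral>\<^sup>+p\<in>ball x r. ennreal (3 powr (- lam)) * (W0 (?u p q) * H (?u p q)) \<partial>lborel) \<partial>lborel)
         + (\<integral>\<^sup>+q\<in>ball x r. (\<integral>\<^sup>+p\<in>ball x r. W p * H (?u p q) * indicator {p. 3 * norm p < norm (?u p q)} p \<partial>lborel) \<partial>lborel)"
      by (rule nn_integral_add) measurable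
    also have "(\<integral>\<^sup>+q\<in>ball x r. (\<integral>\<^sup>+p\<in>ball x r. ennreal (3 powr (- lam)) * (W0 (?u p q) * H (?u p q)) \<partial>lborel) \<partial>lborel)
        \<le> 2 ^ ?N * emeasure lborel (ball x r) * (\<integral>\<^sup>+u\<in>ball x r. ennreal (3 powr (- lam)) * (W0 u * H u) \<partial>lborel)"
      using s by (intro nn_integral_segment_le[where h = "\<lambda>u. ennreal (3 powr (- lam)) * (W0 u * H u)"]) auto
    \<comment> \<open>The modified weight differs from \<open>W\<close> only at the origin, a null
      set.\<close>
    also have "(\<integral>\<^sup>+u\<in>ball x r. ennreal (3 powr (- lam)) * (W0 u * H u) \<partial>lborel) = (\<integral>\<^sup>+u. ennreal (3 powr (- lam)) * (W u * H u * indicator (ball x r) u) \<partial>lborel)"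
      by (rule nn_integral_cong_AE, rule eventually_mono[OF AE_lborel_singleton[of "0::'a"]])
         (simp add: W0_def mult.assoc)
    also have "\<dots> = ennreal (3 powr (- lam)) * ?I"
      by (rule nn_integral_cmult) measurable
    also have "(\<integral>\<^sup>+q\<in>ball x r. (\<integral>\<^sup>+p\<in>ball x r. W p * H (?u p q) * indicator {p. 3 * norm p < norm (?u p q)} p \<partial>lborel) \<partial>lborel)
        \<le> ennreal ((3 * r) ^ ?N) * ennreal J * ?I"
      unfolding W_def J[symmetric] using H s r lam(1) by (rule segment_kernel_far)
    also have "2 ^ ?N * emeasure lborel (ball x r) * (ennreal (3 powr (- lam)) * ?I) + ennreal ((3 * r) ^ ?N) * ennreal J * ?I
      = ennreal K * emeasure lborel (ball x r) * ?I"
    proof -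
      have e: "emeasure lborel (ball x r) = ennreal (?v * r ^ ?N)" using r by (simp add: emeasure_ball)
      have "2 ^ ?N * ennreal (?v * r ^ ?N) * ennreal (3 powr (- lam)) + ennreal ((3 * r) ^ ?N) * ennreal J
        = ennreal (2 ^ ?N * (?v * r ^ ?N) * 3 powr (- lam) + (3 * r) ^ ?N * J)"
        using r v \<open>0 \<le> J\<close> by (simp add: ennreal_mult ennreal_plus flip: ennreal_power)
      also have "2 ^ ?N * (?v * r ^ ?N) * 3 powr (- lam) + (3 * r) ^ ?N * J = K * (?v * r ^ ?N)"
        using v[THEN less_imp_neq, symmetric] by (simp add: K_def field_simps)
      also have "ennreal (K * (?v * r ^ ?N)) = ennreal K * ennreal (?v * r ^ ?N)"
        using \<open>0 < K\<close> v r by (intro ennreal_mult) auto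
      finally show ?thesis unfolding e by (simp add: distrib_right[symmetric] mult.assoc[symmetric])
    qed
    finally show "(\<integral>\<^sup>+q\<in>ball x r. (\<integral>\<^sup>+p\<in>ball x r. ennreal (norm p powr lam) * H (?u p q) \<partial>lborel) \<partial>lborel)
      \<le> ennreal K * emeasure lborel (ball x r) * (\<integral>\<^sup>+u\<in>ball x r. ennreal (norm u powr lam) * H u \<partial>lborel)"
      unfolding W_def by (simp add: add_mono)
  qed
qed

section \<open>Gradient bounds along Lipschitz curves\<close>

text \<open>This replaces the fundamental theorem of calculus where \<open>h\<close> need not be
  differentiable. The inequality with an error proportional to the length of the interval is stable
  under concatenation and holds on short intervals around each point, so bisection extends it to the
  whole interval.\<close>

lemma ftc_bound_of_local_bound:
  fixes h \<psi> :: "real \<Rightarrow> real"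
  assumes "continuous_on {0..1} \<psi>"
    and loc: "\<And>x e. 0 \<le> x \<Longrightarrow> x \<le> 1 \<Longrightarrow> 0 < e \<Longrightarrow>
      \<exists>d>0. \<forall>t\<in>{0..1}. \<bar>t - x\<bar> < d \<longrightarrow> \<bar>h t - h x\<bar> \<le> (\<psi> x + e) * \<bar>t - x\<bar>"
  shows "\<bar>h 1 - h 0\<bar> \<le> integral {0..1} \<psi>"
proof (rule field_le_epsilon)
  fix \<epsilon> :: real assume "0 < \<epsilon>"
  define e where "e = \<epsilon> / 2"
  have e: "0 < e" using \<open>0 < \<epsilon>\<close> by (simp add: e_def)
  have int: "\<psi> integrable_on {a..b}" if "0 \<le> a" "b \<le> 1" for a b
    using that by (intro integrable_continuous_interval continuous_on_subset[OF assms(1)]) auto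
  \<comment> \<open>The premises on \<open>a\<close> and \<open>b\<close> sit inside
    \<open>P\<close> because the local condition of \<open>Bolzano\<close> also covers short
    intervals that leave the unit interval.\<close>
  define P where "P a b \<longleftrightarrow> (0 \<le> a \<longrightarrow> b \<le> 1 \<longrightarrow> \<bar>h b - h a\<bar> \<le> integral {a..b} \<psi> + 2 * e * (b - a))" for a b
  have "P 0 1"
  proof (rule Bolzano)
    show "(0::real) \<le> 1" by simp
  next
    fix a b c assume trans: "P a b" "P b c" "a \<le> b" "b \<le> c"
    show "P a c"
      unfolding P_def
    proof (intro impI)
      assume "0 \<le> a" "c \<le> 1"
      then have "integral {a..b} \<psi> + integral {b..c} \<psi> = integral {a..c} \<psi>"
        using trans by (intro Henstock_Kurzweil_Integration.integral_combine int) auto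
      then show "\<bar>h c - h a\<bar> \<le> integral {a..c} \<psi> + 2 * e * (c - a)"
        using trans \<open>0 \<le> a\<close> \<open>c \<le> 1\<close> by (simp add: P_def algebra_simps)
    qed
  next
    fix x :: real assume local: "0 \<le> x" "x \<le> 1"
    obtain d1 where "0 < d1" and d1: "\<And>t. t \<in> {0..1} \<Longrightarrow> \<bar>t - x\<bar> < d1 \<Longrightarrow> \<bar>h t - h x\<bar> \<le> (\<psi> x + e) * \<bar>t - x\<bar>"
      using loc[OF local e] by blast
    obtain d2 where "0 < d2" and d2: "\<And>t. t \<in> {0..1} \<Longrightarrow> dist t x < d2 \<Longrightarrow> dist (\<psi> t) (\<psi> x) < e"
      using assms(1) local e unfolding continuous_on_iff by (metis atLeastAtMost_iff)
    show "\<exists>d>0. \<forall>a b. a \<le> x \<and> x \<le> b \<and> b - a < d \<longrightarrow> P a b"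
      unfolding P_def
    proof (intro exI[of _ "min d1 d2"] conjI allI impI)
      show "0 < min d1 d2" using \<open>0 < d1\<close> \<open>0 < d2\<close> by simp
      fix a b :: real
      assume *: "a \<le> x \<and> x \<le> b \<and> b - a < min d1 d2" "0 \<le> a" "b \<le> 1"
      have "\<bar>h b - h a\<bar> \<le> \<bar>h b - h x\<bar> + \<bar>h a - h x\<bar>" by simp
      also have "\<dots> \<le> (\<psi> x + e) * (b - x) + (\<psi> x + e) * (x - a)"
        using d1[of a] d1[of b] * by (intro add_mono) auto
      \<comment> \<open>One \<open>e\<close> comes from the local bound on \<open>h\<close>; the
        other pays for replacing \<open>\<psi> x\<close> by the nearby values of
        \<open>\<psi>\<close> under the integral.\<close>
      also have "\<dots> = (\<psi> x - e) * (b - a) + 2 * e * (b - a)" by (simp add: algebra_simps)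
      also have "(\<psi> x - e) * (b - a) = integral {a..b} (\<lambda>_. \<psi> x - e)" using * by simp
      also have "integral {a..b} (\<lambda>_. \<psi> x - e) \<le> integral {a..b} \<psi>"
      proof (rule integral_le)
        fix t assume t: "t \<in> {a..b}"
        then have "\<bar>t - x\<bar> < d2" using * by (auto simp: abs_less_iff)
        then show "\<psi> x - e \<le> \<psi> t" using d2[of t] t * by (auto simp: dist_real_def)
      qed (use * int in auto)
      finally show "\<bar>h b - h a\<bar> \<le> integral {a..b} \<psi> + 2 * e * (b - a)" by simp
    qed
  qed
  then show "\<bar>h 1 - h 0\<bar> \<le> integral {0..1} \<psi> + \<epsilon>" by (simp add: P_def e_def)
qed

text \<open>The curve may lack a derivative, so there is no chain rule. Differentiability of
  \<open>f\<close> at a point of the curve, combined with the Lipschitz bound on the increments of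
  the curve, still gives the local estimate.\<close>

lemma gradient_bound_along_lipschitz_curve:
  fixes f :: "'a::euclidean_space \<Rightarrow> real" and \<sigma> :: "real \<Rightarrow> 'a"
  assumes grad: "\<And>y. y \<in> U \<Longrightarrow> GDERIV f y :> g y" and g: "continuous_on U g"
    and lip: "L-lipschitz_on {0..1} \<sigma>" and U: "\<sigma> ` {0..1} \<subseteq> U"
  shows "\<bar>f (\<sigma> 1) - f (\<sigma> 0)\<bar> \<le> integral {0..1} (\<lambda>s. L * norm (g (\<sigma> s)))"
proof (rule ftc_bound_of_local_bound[where h = "\<lambda>s. f (\<sigma> s)"])
  have L: "0 \<le> L" using lip by (rule lipschitz_on_nonneg)
  have \<sigma>: "continuous_on {0..1} \<sigma>" using lip by (rule lipschitz_on_continuous_on)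
  show "continuous_on {0..1} (\<lambda>s. L * norm (g (\<sigma> s)))"
    using continuous_on_compose2[OF g \<sigma> U] by (intro continuous_intros)
  fix x e :: real assume x: "0 \<le> x" "x \<le> 1" and "0 < e"
  \<comment> \<open>Dividing by \<open>L + 1\<close> avoids a case distinction for
    \<open>L = 0\<close>; the radius \<open>d / (L + 1)\<close> below has the same form for the same
    reason.\<close>
  define e' where "e' = e / (L + 1)"
  have e': "0 < e'" "L * e' \<le> e" using L \<open>0 < e\<close> by (auto simp: e'_def field_simps)
  have "(f has_derivative (\<lambda>v. v \<bullet> g (\<sigma> x))) (at (\<sigma> x))"
    using grad[of "\<sigma> x"] U x by (auto simp: gderiv_def image_subset_iff)
  then obtain d where "0 < d" and d: "\<And>y. norm (y - \<sigma> x) < d \<Longrightarrow>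
      norm (f y - f (\<sigma> x) - (y - \<sigma> x) \<bullet> g (\<sigma> x)) \<le> e' * norm (y - \<sigma> x)"
    using e'(1) unfolding has_derivative_at_alt by blast
  show "\<exists>d>0. \<forall>t\<in>{0..1}. \<bar>t - x\<bar> < d \<longrightarrow>
      \<bar>f (\<sigma> t) - f (\<sigma> x)\<bar> \<le> (L * norm (g (\<sigma> x)) + e) * \<bar>t - x\<bar>"
  proof (intro exI[of _ "d / (L + 1)"] conjI ballI impI)
    show "0 < d / (L + 1)" using \<open>0 < d\<close> L by simp
    fix t :: real assume t: "t \<in> {0..1}" "\<bar>t - x\<bar> < d / (L + 1)"
    have *: "norm (\<sigma> t - \<sigma> x) \<le> L * \<bar>t - x\<bar>"
      using lipschitz_onD[OF lip, of t x] t x by (simp add: dist_norm)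
    also have "\<dots> \<le> (L + 1) * \<bar>t - x\<bar>" using L by (simp add: mult_right_mono)
    also have "\<dots> < d" using t L by (simp add: field_simps)
    finally have "norm (f (\<sigma> t) - f (\<sigma> x) - (\<sigma> t - \<sigma> x) \<bullet> g (\<sigma> x)) \<le> e' * norm (\<sigma> t - \<sigma> x)"
      by (rule d)
    then have "\<bar>f (\<sigma> t) - f (\<sigma> x)\<bar> \<le> \<bar>(\<sigma> t - \<sigma> x) \<bullet> g (\<sigma> x)\<bar> + e' * norm (\<sigma> t - \<sigma> x)"
      by simp
    also have "\<dots> \<le> norm (\<sigma> t - \<sigma> x) * norm (g (\<sigma> x)) + e' * norm (\<sigma> t - \<sigma> x)"
      using Cauchy_Schwarz_ineq2[of "\<sigma> t - \<sigma> x" "g (\<sigma> x)"] by simp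
    also have "\<dots> = (norm (g (\<sigma> x)) + e') * norm (\<sigma> t - \<sigma> x)" by (simp add: algebra_simps)
    also have "\<dots> \<le> (norm (g (\<sigma> x)) + e') * (L * \<bar>t - x\<bar>)"
      using * e' by (intro mult_left_mono) auto
    also have "\<dots> = (L * norm (g (\<sigma> x)) + L * e') * \<bar>t - x\<bar>" by (simp add: algebra_simps)
    also have "\<dots> \<le> (L * norm (g (\<sigma> x)) + e) * \<bar>t - x\<bar>"
      using e' by (intro mult_right_mono) auto
    finally show "\<bar>f (\<sigma> t) - f (\<sigma> x)\<bar> \<le> (L * norm (g (\<sigma> x)) + e) * \<bar>t - x\<bar>" .
  qed
qed

text \<open>The Cauchy-Schwarz inequality on the unit interval, read off from the nonnegative
  variance of \<open>\<psi>\<close> about its mean \<open>m\<close>.\<close>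

lemma square_integral_le:
  fixes \<psi> :: "real \<Rightarrow> real"
  assumes "continuous_on {0..1} \<psi>"
  shows "(integral {0..1} \<psi>)\<^sup>2 \<le> integral {0..1} (\<lambda>s. (\<psi> s)\<^sup>2)"
proof -
  define m where "m = integral {0..1} \<psi>"
  have i: "\<psi> integrable_on {0..1}" "(\<lambda>s. (\<psi> s)\<^sup>2) integrable_on {0..1}"
    using assms by (auto intro!: integrable_continuous_interval continuous_intros)
  have "0 \<le> integral {0..1} (\<lambda>s. (\<psi> s - m)\<^sup>2)"
    using assms by (intro integral_nonneg integrable_continuous_interval continuous_intros) auto
  also have "(\<lambda>s. (\<psi> s - m)\<^sup>2) = (\<lambda>s. (\<psi> s)\<^sup>2 - (2 * m) * \<psi> s + m\<^sup>2)"
    by (auto simp: power2_eq_square algebra_simps)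
  also have "integral {0..1} \<dots> = integral {0..1} (\<lambda>s. (\<psi> s)\<^sup>2) - 2 * m * m + m\<^sup>2"
    using has_integral_add[OF has_integral_diff[OF integrable_integral[OF i(2)]
          has_integral_mult_right[OF integrable_integral[OF i(1)], of "2 * m"]]
        has_integral_const_real[of "m\<^sup>2" 0 1]]
    by (intro integral_unique) (simp add: m_def)
  finally show ?thesis by (simp add: m_def power2_eq_square)
qed

text \<open>The gradient bound in the shape of the hypothesis \<open>grad\<close> of
  \<open>infimum_le_segment_energy\<close>: squared, with an extended nonnegative integral over the
  open interval.\<close>

lemma square_gradient_bound_along_lipschitz_curve:
  fixes f :: "'a::euclidean_space \<Rightarrow> real" and \<sigma> :: "real \<Rightarrow> 'a"
  assumes grad: "\<And>y. y \<in> U \<Longrightarrow> GDERIV f y :> g y" and g: "continuous_on U g"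
    and lip: "L-lipschitz_on {0..1} \<sigma>" and U: "\<sigma> ` {0..1} \<subseteq> U"
  shows "ennreal (\<bar>f (\<sigma> 1) - f (\<sigma> 0)\<bar>\<^sup>2)
    \<le> ennreal (L\<^sup>2) * (\<integral>\<^sup>+s\<in>{0<..<1}. ennreal ((norm (g (\<sigma> s)))\<^sup>2) \<partial>lborel)"
proof -
  let ?\<psi> = "\<lambda>s. norm (g (\<sigma> s))"
  have L: "0 \<le> L" using lip by (rule lipschitz_on_nonneg)
  have cont: "continuous_on {0..1} ?\<psi>"
    using continuous_on_compose2[OF g lipschitz_on_continuous_on[OF lip] U] by (intro continuous_intros)
  have "\<bar>f (\<sigma> 1) - f (\<sigma> 0)\<bar>\<^sup>2 \<le> (integral {0..1} (\<lambda>s. L * ?\<psi> s))\<^sup>2"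
    using gradient_bound_along_lipschitz_curve[OF assms] by (intro power_mono) auto
  also have "\<dots> = L\<^sup>2 * (integral {0..1} ?\<psi>)\<^sup>2" by (simp add: power_mult_distrib)
  also have "\<dots> \<le> L\<^sup>2 * integral {0..1} (\<lambda>s. (?\<psi> s)\<^sup>2)"
    using square_integral_le[OF cont] by (intro mult_left_mono) auto
  finally have "ennreal (\<bar>f (\<sigma> 1) - f (\<sigma> 0)\<bar>\<^sup>2) \<le> ennreal (L\<^sup>2) * ennreal (integral {0..1} (\<lambda>s. (?\<psi> s)\<^sup>2))"
    by (simp add: ennreal_mult'[symmetric] ennreal_leI)
  also have "ennreal (integral {0..1} (\<lambda>s. (?\<psi> s)\<^sup>2)) = (\<integral>\<^sup>+s\<in>{0..1}. ennreal ((?\<psi> s)\<^sup>2) \<partial>lborel)"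
  proof -
    have "set_integrable lborel {0..1} (\<lambda>s. (?\<psi> s)\<^sup>2)"
      using cont by (intro borel_integrable_atLeastAtMost') (auto intro!: continuous_intros)
    then have "integral {0..1} (\<lambda>s. (?\<psi> s)\<^sup>2) = (LINT s:{0..1}|lborel. (?\<psi> s)\<^sup>2)"
      by (simp add: set_borel_integral_eq_integral)
    also have "ennreal \<dots> = (\<integral>\<^sup>+s. ennreal (indicator {0..1} s * (?\<psi> s)\<^sup>2) \<partial>lborel)"
      using \<open>set_integrable lborel {0..1} (\<lambda>s. (?\<psi> s)\<^sup>2)\<close>
      unfolding set_lebesgue_integral_def set_integrable_def
      by (subst nn_integral_eq_integral) auto
    also have "\<dots> = (\<integral>\<^sup>+s\<in>{0..1}. ennreal ((?\<psi> s)\<^sup>2) \<partial>lborel)"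
      by (intro nn_integral_cong) (auto split: split_indicator)
    finally show ?thesis .
  qed
  also have "\<dots> = (\<integral>\<^sup>+s\<in>{0<..<1}. ennreal ((?\<psi> s)\<^sup>2) \<partial>lborel)"
    by (rule nn_integral_cong_AE, rule AE_mp[OF AE_conjI[OF AE_lborel_singleton[of "0::real"] AE_lborel_singleton[of "1::real"]]])
       (auto split: split_indicator)
  finally show ?thesis .
qed

section \<open>The inequality on interior balls\<close>

text \<open>Outside the closure \<open>f\<close> and \<open>g\<close> are arbitrary. Truncation
  makes them Borel functions on the whole space, as the integral estimates require.\<close>

lemma C1_closure_borel_extension:
  assumes "C1_closure S f g"
  shows "(\<lambda>y. indicator (closure S) y *\<^sub>R f y) \<in> borel_measurable borel"
    and "(\<lambda>y. indicator (closure S) y *\<^sub>R g y) \<in> borel_measurable borel"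
  using assms unfolding C1_closure_def
  by (auto intro!: borel_measurable_continuous_on_indicator simp del: real_scaleR_def)

text \<open>The factor \<open>m\<close> stands for the power of the distance to the boundary. Its
  upper bound is used at \<open>p\<close> and its lower bound at the point of the segment, so
  \<open>\<mu>\<close> disappears and only the ratio \<open>\<kappa>\<close> remains. The gradient
  bound contributes the square of the diameter \<open>2 * r\<close>.\<close>

lemma poincare_ball_norm_powr:
  assumes lam: "- real CARD('n) < lam" "lam \<le> 0"
  obtains K where "0 < K"
    "\<And>x r \<mu> \<kappa> m f g. \<lbrakk>0 < r; 0 \<le> \<mu>; 0 \<le> \<kappa>; m \<in> borel_measurable borel;
        \<And>y. y \<in> ball x r \<Longrightarrow> \<mu> \<le> m y \<and> m y \<le> \<kappa> * \<mu>; C1_closure (ball x r) f g\<rbrakk> \<Longrightarrow>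
      (INF \<xi>\<in>(UNIV :: real set). \<integral>\<^sup>+y\<in>ball (x :: real^'n) r. ennreal (norm y powr lam * m y * \<bar>f y - \<xi>\<bar>\<^sup>2) \<partial>lborel)
      \<le> ennreal (K * \<kappa> * r\<^sup>2) * (\<integral>\<^sup>+y\<in>ball x r. ennreal (norm y powr lam * m y * (norm (g y))\<^sup>2) \<partial>lborel)"
proof -
  have "- real DIM(real^'n) < lam" using lam by simp
  then obtain K where "0 < K" and K: "\<And>(x :: real^'n) r s H. \<lbrakk>0 < r; 0 < s; s < 1; H \<in> borel_measurable borel\<rbrakk> \<Longrightarrow>
      (\<integral>\<^sup>+q\<in>ball x r. (\<integral>\<^sup>+p\<in>ball x r. ennreal (norm p powr lam) * H (q + s *\<^sub>R (p - q)) \<partial>lborel) \<partial>lborel)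
      \<le> ennreal K * emeasure lborel (ball x r) * (\<integral>\<^sup>+u\<in>ball x r. ennreal (norm u powr lam) * H u \<partial>lborel)"
    using segment_kernel_norm_powr[OF _ lam(2)] by blast
  show ?thesis
  proof
    show "0 < 4 * K" using \<open>0 < K\<close> by simp
    fix x :: "real^'n" and r \<mu> \<kappa> :: real and m f :: "real^'n \<Rightarrow> real" and g :: "real^'n \<Rightarrow> real^'n"
    assume r: "0 < r" and \<mu>: "0 \<le> \<mu>" and \<kappa>: "0 \<le> \<kappa>" and m[measurable]: "m \<in> borel_measurable borel"
      and mb: "\<And>y. y \<in> ball x r \<Longrightarrow> \<mu> \<le> m y \<and> m y \<le> \<kappa> * \<mu>" and C1: "C1_closure (ball x r) f g"
    let ?B = "ball x r"
    have [measurable]: "?B \<in> sets borel" by simp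
    define F where "F y = indicator (closure ?B) y *\<^sub>R f y" for y
    define G where "G y = indicator (closure ?B) y *\<^sub>R g y" for y
    have [measurable]: "F \<in> borel_measurable borel" "G \<in> borel_measurable borel"
      unfolding F_def[abs_def] G_def[abs_def] using C1_closure_borel_extension[OF C1] by auto
    have FG: "F y = f y" "G y = g y" if "y \<in> ?B" for y
      using that closure_subset[of ?B] by (auto simp: F_def G_def)
    define w where "w y = ennreal (norm y powr lam * m y)" for y
    have [measurable]: "w \<in> borel_measurable borel" unfolding w_def by measurable
    define H where "H y = ennreal ((norm (G y))\<^sup>2)" for y
    have [measurable]: "H \<in> borel_measurable borel" unfolding H_def by measurable
    let ?W = "\<lambda>y. ennreal (norm y powr lam)"
    let ?I = "\<integral>\<^sup>+y\<in>?B. w y * H y \<partial>lborel"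
    have "(INF \<xi>\<in>(UNIV :: real set). \<integral>\<^sup>+y\<in>?B. w y * ennreal (\<bar>F y - \<xi>\<bar>\<^sup>2) \<partial>lborel)
      \<le> ennreal ((2 * r)\<^sup>2) * (ennreal (\<kappa> * K) * ?I)"
    proof (rule infimum_le_segment_energy[where E = "?B" and H = H])
      fix p q assume pq: "p \<in> ?B" "q \<in> ?B"
      define \<sigma> where "\<sigma> s = q + s *\<^sub>R (p - q)" for s
      have \<sigma>B: "\<sigma> s \<in> ?B" if "s \<in> {0..1}" for s
        using convexD[OF convex_ball[of x r] pq(2) pq(1), of "1 - s" s] that
        by (simp add: \<sigma>_def algebra_simps)
      have "norm (p - q) \<le> 2 * r"
        using pq norm_triangle_ineq4[of "p - x" "q - x"] by (auto simp: dist_norm norm_minus_commute)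
      then have "\<bar>s - t\<bar> * norm (p - q) \<le> 2 * r * \<bar>s - t\<bar>" for s t
        using mult_left_mono[of "norm (p - q)" "2 * r" "\<bar>s - t\<bar>"] by (simp add: mult.commute)
      then have "(2 * r)-lipschitz_on {0..1} \<sigma>"
        using r by (intro lipschitz_onI) (auto simp: \<sigma>_def dist_norm scaleR_diff_left[symmetric])
      then have "ennreal (\<bar>f (\<sigma> 1) - f (\<sigma> 0)\<bar>\<^sup>2)
        \<le> ennreal ((2 * r)\<^sup>2) * (\<integral>\<^sup>+s\<in>{0<..<1}. ennreal ((norm (g (\<sigma> s)))\<^sup>2) \<partial>lborel)"
        using C1 closure_subset[of ?B] \<sigma>B
        by (intro square_gradient_bound_along_lipschitz_curve[where U = ?B])
           (auto simp: C1_closure_def intro: continuous_on_subset)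
      also have "(\<integral>\<^sup>+s\<in>{0<..<1}. ennreal ((norm (g (\<sigma> s)))\<^sup>2) \<partial>lborel)
          = (\<integral>\<^sup>+s\<in>{0<..<1}. H (q + s *\<^sub>R (p - q)) \<partial>lborel)"
        using \<sigma>B by (intro nn_integral_cong) (auto simp: H_def FG \<sigma>_def simp del: mem_ball split: split_indicator)
      finally show "ennreal (\<bar>F p - F q\<bar>\<^sup>2)
        \<le> ennreal ((2 * r)\<^sup>2) * (\<integral>\<^sup>+s\<in>{0<..<1}. H (q + s *\<^sub>R (p - q)) \<partial>lborel)"
        using pq by (simp add: \<sigma>_def FG del: mem_ball)
    next
      fix s :: real assume s: "0 < s" "s < 1"
      have "ennreal \<mu> * (\<integral>\<^sup>+u\<in>?B. ?W u * H u \<partial>lborel) = (\<integral>\<^sup>+u. ennreal \<mu> * (?W u * H u * indicator ?B u) \<partial>lborel)"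
        by (rule nn_integral_cmult[symmetric]) measurable
      also have "\<dots> \<le> ?I"
      proof (rule nn_integral_mono)
        fix u
        show "ennreal \<mu> * (?W u * H u * indicator ?B u) \<le> w u * H u * indicator ?B u"
        proof (cases "u \<in> ?B")
          case True
          then have "\<mu> * norm u powr lam \<le> norm u powr lam * m u"
            using mb[of u] by (simp add: mult.commute mult_right_mono)
          then have "ennreal \<mu> * ?W u \<le> w u"
            unfolding w_def using \<mu> by (simp add: ennreal_mult[symmetric] ennreal_leI)
          then show ?thesis using True by (simp add: mult_right_mono flip: mult.assoc)
        qed simp
      qed
      finally have lower: "ennreal \<mu> * (\<integral>\<^sup>+u\<in>?B. ?W u * H u \<partial>lborel) \<le> ?I" .
      have "(\<integral>\<^sup>+q\<in>?B. (\<integral>\<^sup>+p\<in>?B. w p * H (q + s *\<^sub>R (p - q)) \<partial>lborel) \<partial>lborel)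
        \<le> (\<integral>\<^sup>+q. ennreal (\<kappa> * \<mu>) * ((\<integral>\<^sup>+p\<in>?B. ?W p * H (q + s *\<^sub>R (p - q)) \<partial>lborel) * indicator ?B q) \<partial>lborel)"
      proof (rule nn_integral_mono)
        fix q
        have "(\<integral>\<^sup>+p\<in>?B. w p * H (q + s *\<^sub>R (p - q)) \<partial>lborel)
          \<le> (\<integral>\<^sup>+p. ennreal (\<kappa> * \<mu>) * (?W p * H (q + s *\<^sub>R (p - q)) * indicator ?B p) \<partial>lborel)"
        proof (rule nn_integral_mono)
          fix p
          show "w p * H (q + s *\<^sub>R (p - q)) * indicator ?B p
            \<le> ennreal (\<kappa> * \<mu>) * (?W p * H (q + s *\<^sub>R (p - q)) * indicator ?B p)"
          proof (cases "p \<in> ?B")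
            case True
            then have "norm p powr lam * m p \<le> (\<kappa> * \<mu>) * norm p powr lam"
              using mb[of p] by (simp add: mult.commute mult_right_mono)
            then have "w p \<le> ennreal (\<kappa> * \<mu>) * ?W p"
              unfolding w_def using \<mu> \<kappa> by (simp add: ennreal_mult[symmetric] ennreal_leI)
            then show ?thesis using True by (simp add: mult_right_mono flip: mult.assoc)
          qed simp
        qed
        also have "\<dots> = ennreal (\<kappa> * \<mu>) * (\<integral>\<^sup>+p\<in>?B. ?W p * H (q + s *\<^sub>R (p - q)) \<partial>lborel)"
          by (rule nn_integral_cmult) measurable
        finally show "(\<integral>\<^sup>+p\<in>?B. w p * H (q + s *\<^sub>R (p - q)) \<partial>lborel) * indicator ?B q
           \<le> ennreal (\<kappa> * \<mu>) * ((\<integral>\<^sup>+p\<in>?B. ?W p * H (q + s *\<^sub>R (p - q)) \<partial>lborel) * indicator ?B q)"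
          by (simp add: mult_right_mono flip: mult.assoc)
      qed
      also have "\<dots> = ennreal (\<kappa> * \<mu>) * (\<integral>\<^sup>+q\<in>?B. (\<integral>\<^sup>+p\<in>?B. ?W p * H (q + s *\<^sub>R (p - q)) \<partial>lborel) \<partial>lborel)"
        by (rule nn_integral_cmult) measurable
      also have "\<dots> \<le> ennreal (\<kappa> * \<mu>) * (ennreal K * emeasure lborel ?B * (\<integral>\<^sup>+u\<in>?B. ?W u * H u \<partial>lborel))"
        using r s by (intro mult_left_mono K) auto
      also have "\<dots> = ennreal (\<kappa> * K) * emeasure lborel ?B * (ennreal \<mu> * (\<integral>\<^sup>+u\<in>?B. ?W u * H u \<partial>lborel))"
        using \<mu> \<kappa> \<open>0 < K\<close> by (simp add: ennreal_mult mult_ac)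
      also have "\<dots> \<le> ennreal (\<kappa> * K) * emeasure lborel ?B * ?I"
        using lower by (rule mult_left_mono) simp
      finally show "(\<integral>\<^sup>+q\<in>?B. (\<integral>\<^sup>+p\<in>?B. w p * H (q + s *\<^sub>R (p - q)) \<partial>lborel) \<partial>lborel)
        \<le> ennreal (\<kappa> * K) * ?I * emeasure lborel ?B"
        by (simp add: mult_ac)
    next
      show "emeasure lborel ?B \<noteq> 0" "emeasure lborel ?B \<noteq> \<infinity>"
        using r unit_ball_vol_pos[of "real CARD('n)"]
        by (auto simp: emeasure_ball simp del: unit_ball_vol_pos)
    qed measurable
    moreover have "(\<integral>\<^sup>+y\<in>?B. w y * ennreal (\<bar>F y - \<xi>\<bar>\<^sup>2) \<partial>lborel)
        = (\<integral>\<^sup>+y\<in>?B. ennreal (norm y powr lam * m y * \<bar>f y - \<xi>\<bar>\<^sup>2) \<partial>lborel)" for \<xi>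
      by (intro nn_integral_cong) (auto simp: w_def FG ennreal_mult''[symmetric] simp del: mem_ball split: split_indicator)
    moreover have "?I = (\<integral>\<^sup>+y\<in>?B. ennreal (norm y powr lam * m y * (norm (g y))\<^sup>2) \<partial>lborel)"
      by (intro nn_integral_cong) (auto simp: w_def H_def FG ennreal_mult''[symmetric] simp del: mem_ball split: split_indicator)
    moreover have "ennreal ((2 * r)\<^sup>2) * ennreal (\<kappa> * K) = ennreal (4 * K * \<kappa> * r\<^sup>2)"
      using \<kappa> \<open>0 < K\<close> by (simp add: ennreal_mult[symmetric] power_mult_distrib mult_ac)
    ultimately show "(INF \<xi>\<in>(UNIV :: real set). \<integral>\<^sup>+y\<in>?B. ennreal (norm y powr lam * m y * \<bar>f y - \<xi>\<bar>\<^sup>2) \<partial>lborel)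
      \<le> ennreal (4 * K * \<kappa> * r\<^sup>2) * (\<integral>\<^sup>+y\<in>?B. ennreal (norm y powr lam * m y * (norm (g y))\<^sup>2) \<partial>lborel)"
      by (simp only: mult.assoc[symmetric])
  qed
qed

section \<open>The inequality on cylinders below a Lipschitz graph\<close>

text \<open>On each vertical line the new variable is the depth below the graph, obtained by a
  reflection and a translation. Fubini therefore gives a measure-preserving change of variables
  although \<open>b\<close> is merely measurable.\<close>

lemma nn_integral_below_graph:
  fixes J :: "'b::euclidean_space \<times> real \<Rightarrow> 'a::euclidean_space"
  assumes J: "distr lborel borel J = lborel" and [measurable]: "J \<in> borel_measurable borel"
    and [measurable]: "b \<in> borel_measurable borel" "h \<in> borel_measurable borel"
  shows "(\<integral>\<^sup>+y. h y \<partial>lborel) = (\<integral>\<^sup>+z. h (J (fst z, b (fst z) - snd z)) \<partial>lborel)"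
proof -
  have [measurable]: "J \<in> borel_measurable (borel \<Otimes>\<^sub>M borel)"
    unfolding borel_prod by measurable
  have Fubini: "(\<integral>\<^sup>+z. k z \<partial>lborel) = (\<integral>\<^sup>+v. \<integral>\<^sup>+t. k (v, t) \<partial>lborel \<partial>lborel)"
    if "k \<in> borel_measurable (borel \<Otimes>\<^sub>M borel)" for k :: "'b \<times> real \<Rightarrow> ennreal"
    unfolding lborel_prod[symmetric] using that by (subst lborel.nn_integral_fst) auto
  have "(\<integral>\<^sup>+y. h y \<partial>lborel) = (\<integral>\<^sup>+z. h (J z) \<partial>lborel)"
    by (subst J[symmetric]) (simp add: nn_integral_distr)
  also have "\<dots> = (\<integral>\<^sup>+v. \<integral>\<^sup>+t. h (J (v, t)) \<partial>lborel \<partial>lborel)"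
    by (rule Fubini) measurable
  also have "\<dots> = (\<integral>\<^sup>+v. \<integral>\<^sup>+t. h (J (v, b v - t)) \<partial>lborel \<partial>lborel)"
  proof (rule nn_integral_cong)
    show "(\<integral>\<^sup>+t. h (J (v, t)) \<partial>lborel) = (\<integral>\<^sup>+t. h (J (v, b v - t)) \<partial>lborel)" for v
      using nn_integral_real_affine[of "\<lambda>t. h (J (v, t))" "-1" "b v"] by simp
  qed
  also have "\<dots> = (\<integral>\<^sup>+z. h (J (fst z, b (fst z) - snd z)) \<partial>lborel)"
    by (subst Fubini) simp_all
  finally show ?thesis .
qed

text \<open>With the depth below the graph as last coordinate, \<open>S\<close> becomes a product of
  a convex set and an interval, and segments there map to Lipschitz curves in \<open>S\<close>. The
  constant collects the squared Lipschitz constant of these curves, the loss in moving the weight,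
  the factor of \<open>nn_integral_segment_le\<close> and the ratio 2 of the measures of
  \<open>D\<close> and \<open>E\<close>.\<close>

lemma poincare_graph_cylinder:
  fixes T :: "real^'n \<Rightarrow> (real^'m) \<times> real" and b :: "real^'m \<Rightarrow> real"
  assumes dim: "CARD('n) = CARD('m) + 1" and T: "coordinate_system T"
    and lip: "A-lipschitz_on UNIV b"
    and K: "convex K" "closed K" "K \<subseteq> cball c r"
    and t: "0 \<le> t0" "t0 < t1" "t1 \<le> 3 * r"
    and S: "S = {y. fst (T y) \<in> K \<and> t0 < b (fst (T y)) - snd (T y) \<and> b (fst (T y)) - snd (T y) < t1}"
    and w[measurable]: "w \<in> borel_measurable borel"
    and c: "0 < c1" "0 < c2" and "0 < \<alpha>"
    and wb: "\<And>y. y \<in> S \<Longrightarrow> c1 * (b (fst (T y)) - snd (T y)) powr \<alpha> \<le> w y \<and> w y \<le> c2 * (b (fst (T y)) - snd (T y)) powr \<alpha>"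
    and C1: "C1_closure S f g"
  shows "(INF \<xi>\<in>(UNIV :: real set). \<integral>\<^sup>+y\<in>S. ennreal (w y * \<bar>f y - \<xi>\<bar>\<^sup>2) \<partial>lborel)
    \<le> ennreal ((5 + 2 * A)\<^sup>2 * (c2 / c1 * 2 powr \<alpha>) * 2 ^ CARD('n) * 2 * r\<^sup>2)
      * (\<integral>\<^sup>+y\<in>S. ennreal (w y * (norm (g y))\<^sup>2) \<partial>lborel)"
proof -
  define \<kappa> where "\<kappa> = c2 / c1 * 2 powr \<alpha>"
  have \<kappa>: "0 < \<kappa>" using c by (simp add: \<kappa>_def)
  have r: "0 < r" using t by linarith
  have A: "0 \<le> A" using lip by (rule lipschitz_on_nonneg)
  have Tdist: "dist (T p) (T q) = dist p q" and "surj T" for p q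
    using T by (auto simp: coordinate_system_def)
  define J where "J = inv T"
  have TJ: "T (J z) = z" for z using \<open>surj T\<close> by (simp add: J_def surj_f_inv_f)
  have "inj T" using Tdist by (metis dist_eq_0_iff injI)
  then have JT: "J (T y) = y" for y by (simp add: J_def)
  have Jdist: "dist (J z) (J z') = dist z z'" for z z' using Tdist[of "J z" "J z'"] by (simp add: TJ)
  have "surj J" using JT by (metis surjI)
  have J: "distr lborel borel J = lborel"
    using dim by (intro distr_lborel_isometry Jdist \<open>surj J\<close>) simp
  have contJ: "continuous_on UNIV J" and contT: "continuous_on UNIV T"
    by (rule lipschitz_on_continuous_on[of 1]; auto simp: lipschitz_on_def Jdist Tdist)+
  have contb: "continuous_on UNIV b" using lip by (rule lipschitz_on_continuous_on)
  have [measurable]: "J \<in> borel_measurable borel" "b \<in> borel_measurable borel" "T \<in> borel_measurable borel"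
    using contJ contb contT by (auto intro: borel_measurable_continuous_onI)
  define \<Phi> where "\<Phi> z = J (fst z, b (fst z) - snd z)" for z
  have T\<Phi>: "T (\<Phi> z) = (fst z, b (fst z) - snd z)" for z by (simp add: \<Phi>_def TJ)
  have cont\<Phi>: "continuous_on UNIV \<Phi>"
    unfolding \<Phi>_def
    by (intro continuous_on_compose2[OF contJ] continuous_on_compose2[OF contb] continuous_intros) auto
  then have [measurable]: "\<Phi> \<in> borel_measurable borel" by (rule borel_measurable_continuous_onI)
  have \<Phi>_int: "(\<integral>\<^sup>+y. h y \<partial>lborel) = (\<integral>\<^sup>+z. h (\<Phi> z) \<partial>lborel)" if [measurable]: "h \<in> borel_measurable borel" for h
    unfolding \<Phi>_def by (rule nn_integral_below_graph[OF J]) measurable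
  have S\<Phi>: "\<Phi> z \<in> S \<longleftrightarrow> z \<in> K \<times> {t0<..<t1}" for z
    by (cases z) (auto simp: S T\<Phi>)

  \<comment> \<open>Gradients are available only in the interior of \<open>S\<close>, whereas
    \<open>K\<close> is closed; \<open>D\<close> is mapped into that interior. Passing from
    \<open>K\<close> to its interior does not change integrals, since the frontier of a convex set
    is null.\<close>
  define D where "D = interior K \<times> {t0<..<t1}"
  define E where "E = interior K \<times> {(t0 + t1) / 2<..<t1}"
  have "open D" "open E" by (auto simp: D_def E_def open_Times)
  then have [measurable]: "D \<in> sets borel" "E \<in> sets borel" by auto
  have ED: "E \<subseteq> D" using t by (auto simp: D_def E_def)
  have "convex D" unfolding D_def using K by (intro convex_Times convex_interior) auto
  have D\<Phi>: "\<Phi> z \<in> interior S" if "z \<in> D" for z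
  proof (rule interiorI)
    let ?O = "{y. fst (T y) \<in> interior K} \<inter> {y. t0 < b (fst (T y)) - snd (T y)} \<inter> {y. b (fst (T y)) - snd (T y) < t1}"
    have c: "continuous_on UNIV (\<lambda>y. fst (T y))" "continuous_on UNIV (\<lambda>y. b (fst (T y)) - snd (T y))"
      by (intro continuous_on_compose2[OF contb] continuous_intros contT; simp)+
    have "open {y. fst (T y) \<in> interior K}"
      using open_vimage[OF open_interior c(1)] by (simp add: vimage_def)
    then show "open ?O"
      using open_Collect_less[OF continuous_on_const c(2)] open_Collect_less[OF c(2) continuous_on_const]
      by (intro open_Int) auto
    show "\<Phi> z \<in> ?O" using that by (auto simp: D_def T\<Phi>)
    show "?O \<subseteq> S" using interior_subset[of K] by (auto simp: S)
  qed
  then have DS: "\<Phi> z \<in> S" if "z \<in> D" for z using that interior_subset by blast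
  have [measurable]: "S \<in> sets borel"
  proof -
    have [measurable]: "K \<in> sets borel" using K by simp
    have [measurable]: "T \<in> borel \<rightarrow>\<^sub>M borel \<Otimes>\<^sub>M borel" unfolding borel_prod by measurable
    show ?thesis unfolding S by measurable
  qed

  have "frontier K \<in> null_sets lborel"
    using negligible_convex_frontier[OF K(1)]
    by (simp add: negligible_iff_null_sets null_sets_completion_iff)
  then have "emeasure lborel (frontier K) = 0" by auto
  moreover have "emeasure lborel (frontier K \<times> (UNIV :: real set)) = emeasure lborel (frontier K) * emeasure lborel (UNIV :: real set)"
    unfolding lborel_prod[symmetric] by (intro lborel.emeasure_pair_measure_Times) auto
  ultimately have "frontier K \<times> (UNIV :: real set) \<in> null_sets lborel"
    by (intro null_setsI) (auto simp: closed_Times)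
  then have "AE z in lborel. z \<notin> frontier K \<times> (UNIV :: real set)" by (rule AE_not_in)
  then have AE_D: "AE z in lborel. indicator S (\<Phi> z) = (indicator D z :: ennreal)"
  proof (rule eventually_mono)
    fix z assume "z \<notin> frontier K \<times> (UNIV :: real set)"
    then show "indicator S (\<Phi> z) = (indicator D z :: ennreal)"
      using closure_subset[of K] interior_subset[of K]
      by (cases z) (auto simp: indicator_def S\<Phi> D_def frontier_def)
  qed
  define F where "F y = indicator (closure S) y *\<^sub>R f y" for y
  define G where "G y = indicator (closure S) y *\<^sub>R g y" for y
  have [measurable]: "F \<in> borel_measurable borel" "G \<in> borel_measurable borel"
    unfolding F_def[abs_def] G_def[abs_def] using C1_closure_borel_extension[OF C1] by auto
  have FG: "F y = f y" "G y = g y" if "y \<in> S" for y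
    using that closure_subset[of S] by (auto simp: F_def G_def)
  define W where "W z = ennreal (w (\<Phi> z))" for z
  define H where "H z = ennreal ((norm (G (\<Phi> z)))\<^sup>2)" for z
  have [measurable]: "W \<in> borel_measurable borel" "H \<in> borel_measurable borel"
    unfolding W_def H_def by measurable
  have pull: "(\<integral>\<^sup>+y\<in>S. h y \<partial>lborel) = (\<integral>\<^sup>+z\<in>D. h (\<Phi> z) \<partial>lborel)"
    if [measurable]: "h \<in> borel_measurable borel" for h :: "real^'n \<Rightarrow> ennreal"
  proof -
    have "(\<integral>\<^sup>+y\<in>S. h y \<partial>lborel) = (\<integral>\<^sup>+z. h (\<Phi> z) * indicator S (\<Phi> z) \<partial>lborel)"
      by (rule \<Phi>_int) measurable
    also have "\<dots> = (\<integral>\<^sup>+z\<in>D. h (\<Phi> z) \<partial>lborel)"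
      by (rule nn_integral_cong_AE, rule eventually_mono[OF AE_D]) simp
    finally show ?thesis .
  qed
  have lhs: "(\<integral>\<^sup>+y\<in>S. ennreal (w y * \<bar>f y - \<xi>\<bar>\<^sup>2) \<partial>lborel) = (\<integral>\<^sup>+z\<in>D. W z * ennreal (\<bar>F (\<Phi> z) - \<xi>\<bar>\<^sup>2) \<partial>lborel)" for \<xi>
  proof -
    have "(\<integral>\<^sup>+y\<in>S. ennreal (w y * \<bar>f y - \<xi>\<bar>\<^sup>2) \<partial>lborel) = (\<integral>\<^sup>+y\<in>S. ennreal (w y) * ennreal (\<bar>F y - \<xi>\<bar>\<^sup>2) \<partial>lborel)"
      by (intro nn_integral_cong) (auto simp: FG ennreal_mult''[symmetric] split: split_indicator)
    then show ?thesis unfolding W_def by (subst pull[symmetric]) auto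
  qed
  have rhs: "(\<integral>\<^sup>+y\<in>S. ennreal (w y * (norm (g y))\<^sup>2) \<partial>lborel) = (\<integral>\<^sup>+z\<in>D. W z * H z \<partial>lborel)"
  proof -
    have "(\<integral>\<^sup>+y\<in>S. ennreal (w y * (norm (g y))\<^sup>2) \<partial>lborel) = (\<integral>\<^sup>+y\<in>S. ennreal (w y) * ennreal ((norm (G y))\<^sup>2) \<partial>lborel)"
      by (intro nn_integral_cong) (auto simp: FG ennreal_mult''[symmetric] split: split_indicator)
    then show ?thesis unfolding W_def H_def by (subst pull[symmetric]) auto
  qed

  have "emeasure lborel D = emeasure lborel (interior K) * emeasure lborel {t0<..<t1}"
    "emeasure lborel E = emeasure lborel (interior K) * emeasure lborel {(t0 + t1) / 2<..<t1}"
    unfolding D_def E_def lborel_prod[symmetric] by (intro lborel.emeasure_pair_measure_Times; simp)+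
  moreover have "emeasure lborel {t0<..<t1} = 2 * emeasure lborel {(t0 + t1) / 2<..<t1}"
  proof -
    have "emeasure lborel {(t0 + t1) / 2<..<t1} = ennreal (t1 - (t0 + t1) / 2)"
      using t by (intro emeasure_lborel_Ioo) auto
    also have "2 * \<dots> = ennreal (2 * (t1 - (t0 + t1) / 2))"
      using t by (subst ennreal_mult) auto
    also have "2 * (t1 - (t0 + t1) / 2) = t1 - t0" by (simp add: field_simps)
    finally show ?thesis using t by simp
  qed
  ultimately have DE: "emeasure lborel D = 2 * emeasure lborel E"
    by (simp add: mult_ac)
  have comp: "W p \<le> ennreal \<kappa> * W (q + s *\<^sub>R (p - q))"
    if p: "p \<in> D" and q: "q \<in> E" and s: "0 < s" "s < 1" for p q s
  proof -
    define u where "u = q + s *\<^sub>R (p - q)"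
    have uD: "u \<in> D"
      using convexD[OF \<open>convex D\<close>, of q p "1 - s" s] p q ED s by (auto simp: u_def algebra_simps)
    have pos: "0 < snd p" using p t by (auto simp: D_def)
    have "snd p / 2 \<le> snd u"
    proof -
      \<comment> \<open>Depths in \<open>E\<close> exceed the midpoint of the interval, which is at
        least \<open>t1 / 2\<close> because \<open>t0\<close> is nonnegative, while the depth of
        \<open>p\<close> is below \<open>t1\<close>.\<close>
      have "snd p / 2 \<le> snd q" using p q t by (auto simp: D_def E_def)
      then have "(1 - s) * (snd p / 2) + s * (snd p / 2) \<le> (1 - s) * snd q + s * snd p"
        using s pos by (intro add_mono mult_left_mono) auto
      then show ?thesis by (simp add: u_def algebra_simps diff_divide_distrib)
    qed
    then have "(snd p / 2) powr \<alpha> \<le> snd u powr \<alpha>"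
      using pos \<open>0 < \<alpha>\<close> by (intro powr_mono2) auto
    then have pu: "snd p powr \<alpha> \<le> 2 powr \<alpha> * snd u powr \<alpha>"
      using pos by (simp add: powr_divide field_simps)
    have "w (\<Phi> p) \<le> c2 * snd p powr \<alpha>" using wb[OF DS[OF p]] by (simp add: T\<Phi>)
    also have "\<dots> \<le> c2 * (2 powr \<alpha> * snd u powr \<alpha>)"
      using c pu by (intro mult_left_mono) auto
    also have "\<dots> = \<kappa> * (c1 * snd u powr \<alpha>)" using c by (simp add: \<kappa>_def)
    also have "\<dots> \<le> \<kappa> * w (\<Phi> u)"
      using wb[OF DS[OF uD]] \<kappa> by (intro mult_left_mono) (auto simp: T\<Phi>)
    finally show ?thesis
      unfolding W_def u_def[symmetric] using \<kappa> by (simp add: ennreal_mult'[symmetric] ennreal_leI)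
  qed

  show ?thesis
  proof (cases "emeasure lborel E = 0")
    \<comment> \<open>A degenerate \<open>K\<close> has empty interior, and then \<open>E\<close>
      cannot be averaged over. In that case \<open>D\<close> is null as well, and the choice
      \<open>\<xi> = 0\<close> makes the left side zero.\<close>
    case True
    then have "emeasure lborel D = 0" using DE by simp
    then have "D \<in> null_sets lborel" by (intro null_setsI) auto
    then have "(\<integral>\<^sup>+z\<in>D. W z * ennreal (\<bar>F (\<Phi> z) - 0\<bar>\<^sup>2) \<partial>lborel) = 0"
      by (rule nn_integral_null_set)
    then have "(INF \<xi>\<in>(UNIV :: real set). \<integral>\<^sup>+y\<in>S. ennreal (w y * \<bar>f y - \<xi>\<bar>\<^sup>2) \<partial>lborel) \<le> 0"
      unfolding lhs by (intro INF_lower2[of 0]) auto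
    then show ?thesis by simp
  next
    case False
    have "bounded E"
      unfolding E_def using K interior_subset[of K]
      by (intro bounded_Times bounded_subset[OF bounded_cball[of c r]]) auto
    then have Efin: "emeasure lborel E \<noteq> \<infinity>"
      using emeasure_bounded_finite by (metis infinity_ennreal_def less_irrefl)
    \<comment> \<open>The horizontal displacement contributes \<open>2 * r\<close>, the depth
      \<open>3 * r\<close> and the graph \<open>A * (2 * r)\<close>.\<close>
    let ?L = "(5 + 2 * A) * r"
    let ?I = "\<integral>\<^sup>+z\<in>D. W z * H z \<partial>lborel"
    have "(INF \<xi>\<in>(UNIV :: real set). \<integral>\<^sup>+z\<in>D. W z * ennreal (\<bar>F (\<Phi> z) - \<xi>\<bar>\<^sup>2) \<partial>lborel)
      \<le> ennreal (?L\<^sup>2) * (ennreal (\<kappa> * 2 ^ CARD('n) * 2) * ?I)"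
    proof (rule infimum_le_segment_energy[where E = E and H = H and F = "\<lambda>z. F (\<Phi> z)"])
      fix p q assume pq: "p \<in> D" "q \<in> E"
      define \<sigma> where "\<sigma> s = \<Phi> (q + s *\<^sub>R (p - q))" for s
      have in_D: "q + s *\<^sub>R (p - q) \<in> D" if "s \<in> {0..1}" for s
        using convexD[OF \<open>convex D\<close>, of q p "1 - s" s] pq ED that by (auto simp: algebra_simps)
      have \<sigma>_int: "\<sigma> s \<in> interior S" if "s \<in> {0..1}" for s
        unfolding \<sigma>_def by (intro D\<Phi> in_D that)
      then have \<sigma>_S: "\<sigma> s \<in> S" if "s \<in> {0..1}" for s
        using that interior_subset by blast
      have "?L-lipschitz_on {0..1} \<sigma>"
      proof (rule lipschitz_onI)
        fix s s' :: real
        let ?z = "q + s *\<^sub>R (p - q)" and ?z' = "q + s' *\<^sub>R (p - q)"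
        have "fst p \<in> cball c r" "fst q \<in> cball c r"
          using pq K interior_subset[of K] by (auto simp: D_def E_def)
        then have "norm (fst p - fst q) \<le> 2 * r"
          using norm_triangle_ineq4[of "fst p - c" "fst q - c"] by (auto simp: dist_norm norm_minus_commute)
        then have 1: "dist (fst ?z) (fst ?z') \<le> \<bar>s - s'\<bar> * (2 * r)"
          by (simp add: dist_norm scaleR_diff_left[symmetric] mult_left_mono)
        have "\<bar>snd p - snd q\<bar> \<le> 3 * r"
          using pq t by (auto simp: D_def E_def)
        then have "\<bar>s - s'\<bar> * \<bar>snd p - snd q\<bar> \<le> \<bar>s - s'\<bar> * (3 * r)" by (intro mult_left_mono) auto
        then have 2: "\<bar>snd ?z - snd ?z'\<bar> \<le> \<bar>s - s'\<bar> * (3 * r)"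
          by (simp add: left_diff_distrib[symmetric] abs_mult)
        have "\<bar>b (fst ?z) - b (fst ?z')\<bar> \<le> A * dist (fst ?z) (fst ?z')"
          using lipschitz_onD[OF lip, of "fst ?z" "fst ?z'"] by (simp add: dist_real_def)
        also have "\<dots> \<le> A * (\<bar>s - s'\<bar> * (2 * r))" using 1 A by (intro mult_left_mono)
        finally have 3: "\<bar>b (fst ?z) - b (fst ?z')\<bar> \<le> A * (\<bar>s - s'\<bar> * (2 * r))" .
        have "dist (\<sigma> s) (\<sigma> s') = dist (fst ?z, b (fst ?z) - snd ?z) (fst ?z', b (fst ?z') - snd ?z')"
          by (simp only: \<sigma>_def \<Phi>_def Jdist)
        also have "\<dots> \<le> dist (fst ?z) (fst ?z') + dist (b (fst ?z) - snd ?z) (b (fst ?z') - snd ?z')"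
          unfolding dist_prod_def fst_conv snd_conv by (rule sqrt_sum_squares_le_sum) auto
        also have "\<dots> \<le> \<bar>s - s'\<bar> * (2 * r) + (A * (\<bar>s - s'\<bar> * (2 * r)) + \<bar>s - s'\<bar> * (3 * r))"
          using 1 2 3 by (intro add_mono) (auto simp: dist_real_def)
        also have "\<dots> = ?L * dist s s'" by (simp add: dist_real_def algebra_simps)
        finally show "dist (\<sigma> s) (\<sigma> s') \<le> ?L * dist s s'" .
      qed (use A r in simp)
      then have "ennreal (\<bar>f (\<sigma> 1) - f (\<sigma> 0)\<bar>\<^sup>2)
        \<le> ennreal (?L\<^sup>2) * (\<integral>\<^sup>+s\<in>{0<..<1}. ennreal ((norm (g (\<sigma> s)))\<^sup>2) \<partial>lborel)"
        using C1 closure_subset[of S] interior_subset[of S] \<sigma>_int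
        by (intro square_gradient_bound_along_lipschitz_curve[where U = "interior S"])
           (auto simp: C1_closure_def intro: continuous_on_subset)
      also have "(\<integral>\<^sup>+s\<in>{0<..<1}. ennreal ((norm (g (\<sigma> s)))\<^sup>2) \<partial>lborel)
          = (\<integral>\<^sup>+s\<in>{0<..<1}. H (q + s *\<^sub>R (p - q)) \<partial>lborel)"
        using \<sigma>_S by (intro nn_integral_cong) (auto simp: H_def FG \<sigma>_def[symmetric] split: split_indicator)
      finally show "ennreal (\<bar>F (\<Phi> p) - F (\<Phi> q)\<bar>\<^sup>2)
        \<le> ennreal (?L\<^sup>2) * (\<integral>\<^sup>+s\<in>{0<..<1}. H (q + s *\<^sub>R (p - q)) \<partial>lborel)"
        using FG(1)[OF DS[OF pq(1)]] FG(1)[OF DS[OF subsetD[OF ED pq(2)]]] by (simp add: \<sigma>_def)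
    next
      fix s :: real assume s: "0 < s" "s < 1"
      let ?h = "\<lambda>u. ennreal \<kappa> * (W u * H u)"
      have "(\<integral>\<^sup>+q\<in>E. (\<integral>\<^sup>+p\<in>D. W p * H (q + s *\<^sub>R (p - q)) \<partial>lborel) \<partial>lborel)
        \<le> (\<integral>\<^sup>+q\<in>E. (\<integral>\<^sup>+p\<in>D. ?h (q + s *\<^sub>R (p - q)) \<partial>lborel) \<partial>lborel)"
      proof (rule nn_integral_mono)
        fix q
        have "W p * H (q + s *\<^sub>R (p - q)) \<le> ?h (q + s *\<^sub>R (p - q))" if "p \<in> D" "q \<in> E" for p
          using mult_right_mono[OF comp[OF that s], of "H (q + s *\<^sub>R (p - q))"] by (simp add: mult.assoc)
        then show "(\<integral>\<^sup>+p\<in>D. W p * H (q + s *\<^sub>R (p - q)) \<partial>lborel) * indicator E q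
          \<le> (\<integral>\<^sup>+p\<in>D. ?h (q + s *\<^sub>R (p - q)) \<partial>lborel) * indicator E q"
          by (cases "q \<in> E") (auto intro!: nn_integral_mono split: split_indicator)
      qed
      also have "\<dots> \<le> 2 ^ DIM((real^'m) \<times> real) * emeasure lborel D * (\<integral>\<^sup>+u\<in>D. ?h u \<partial>lborel)"
        using \<open>convex D\<close> ED s by (intro nn_integral_segment_le[where h = ?h]) auto
      also have "(\<integral>\<^sup>+u\<in>D. ?h u \<partial>lborel) = (\<integral>\<^sup>+u. ennreal \<kappa> * (W u * H u * indicator D u) \<partial>lborel)"
        by (simp add: mult.assoc)
      also have "\<dots> = ennreal \<kappa> * ?I"
        by (rule nn_integral_cmult) measurable
      also have "2 ^ DIM((real^'m) \<times> real) * emeasure lborel D * (ennreal \<kappa> * ?I)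
          = ennreal (\<kappa> * 2 ^ CARD('n) * 2) * ?I * emeasure lborel E"
      proof -
        have "ennreal (\<kappa> * 2 ^ CARD('n) * 2) = ennreal \<kappa> * 2 ^ CARD('n) * 2"
          using \<kappa> by (simp add: ennreal_mult flip: ennreal_power)
        then show ?thesis using dim by (simp add: DE mult_ac)
      qed
      finally show "(\<integral>\<^sup>+q\<in>E. (\<integral>\<^sup>+p\<in>D. W p * H (q + s *\<^sub>R (p - q)) \<partial>lborel) \<partial>lborel)
        \<le> ennreal (\<kappa> * 2 ^ CARD('n) * 2) * ?I * emeasure lborel E" .
    qed (use False Efin in measurable)
    also have "\<dots> = ennreal ((5 + 2 * A)\<^sup>2 * \<kappa> * 2 ^ CARD('n) * 2 * r\<^sup>2) * ?I"
    proof -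
      have "ennreal (?L\<^sup>2) * ennreal (\<kappa> * 2 ^ CARD('n) * 2) = ennreal (?L\<^sup>2 * (\<kappa> * 2 ^ CARD('n) * 2))"
        using \<kappa> by (intro ennreal_mult[symmetric]) auto
      also have "?L\<^sup>2 * (\<kappa> * 2 ^ CARD('n) * 2) = (5 + 2 * A)\<^sup>2 * \<kappa> * 2 ^ CARD('n) * 2 * r\<^sup>2"
        by (simp add: power_mult_distrib)
      finally show ?thesis by (simp only: mult.assoc[symmetric])
    qed
    finally show ?thesis unfolding lhs rhs \<kappa>_def .
  qed
qed

section \<open>Interior and boundary balls combined\<close>

theorem theorem2p5:
  fixes \<Omega> :: "(real^'n) set"
    and T :: "nat \<Rightarrow> real^'n \<Rightarrow> (real^'m) \<times> real"
    and a :: "nat \<Rightarrow> real^'m \<Rightarrow> real"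
    and m :: nat
    and \<alpha> lam \<gamma> \<delta> A \<beta>0 :: real
  assumes "CARD('n) \<ge> 2" and "CARD('n) = CARD('m) + 1"
    and "\<alpha> > 0" and "- real CARD('n) < lam" and "lam \<le> 0"
    and "open \<Omega>" and "connected \<Omega>" and "bounded \<Omega>" and "0 \<in> \<Omega>"
    and "C2_boundary TYPE('m) \<Omega>"
    and "boundary_representation \<Omega> m T a \<delta> A \<beta>0"
    and "1 < \<gamma>" and "\<gamma> < 2"
  shows "\<exists>C\<^sub>P \<beta>. C\<^sub>P > 0 \<and> 0 < \<beta> \<and> \<beta> \<le> \<beta>0 \<and>
    (\<forall>x\<in>\<Omega>. \<forall>r. 0 < r \<and> r < \<beta> \<longrightarrow>
      (\<forall>i S f g. projection_index \<Omega> m T a \<delta> x i \<longrightarrow>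
         S = gen_ball \<Omega> \<gamma> \<delta> (T i) (a i) x r \<inter> \<Omega> \<longrightarrow>
         C1_closure S f g \<longrightarrow>
         (INF \<xi>\<in>(UNIV :: real set).
            \<integral>\<^sup>+ y \<in> S. ennreal (norm y powr lam * bdist \<Omega> y powr \<alpha> * \<bar>f y - \<xi>\<bar>\<^sup>2) \<partial>lborel)
         \<le> ennreal (C\<^sub>P * r\<^sup>2) *
            (\<integral>\<^sup>+ y \<in> S. ennreal (norm y powr lam * bdist \<Omega> y powr \<alpha> * (norm (g y))\<^sup>2) \<partial>lborel)))"
proof -
  define w where "w y = norm y powr lam * bdist \<Omega> y powr \<alpha>" for y
  have bdist_diff: "\<bar>bdist \<Omega> y - bdist \<Omega> x\<bar> \<le> dist y x" for x y
    unfolding bdist_def by (rule infdist_triangle_abs)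
  have bdist_nonneg: "0 \<le> bdist \<Omega> y" for y
    unfolding bdist_def by (rule infdist_nonneg)
  have bdist_meas [measurable]: "bdist \<Omega> \<in> borel_measurable borel"
    unfolding bdist_def[abs_def] by (intro borel_measurable_continuous_onI continuous_intros)
  have [measurable]: "w \<in> borel_measurable borel" unfolding w_def by measurable
  \<comment> \<open>The frontier must be nonempty, as \<open>infdist\<close> to the empty set is
    zero by default. Positivity of the distance at the origin is what keeps small boundary balls
    away from the singularity of the weight.\<close>
  have "\<Omega> \<noteq> UNIV" using \<open>bounded \<Omega>\<close> not_bounded_UNIV by auto
  then have "frontier \<Omega> \<noteq> {}" using \<open>0 \<in> \<Omega>\<close> frontier_eq_empty by blast
  moreover have "0 \<notin> frontier \<Omega>" using \<open>open \<Omega>\<close> \<open>0 \<in> \<Omega>\<close> frontier_disjoint_eq by blast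
  ultimately have d0: "0 < bdist \<Omega> 0"
    unfolding bdist_def by (intro infdist_pos_not_in_closed) auto
  obtain M where M: "0 < M" "\<And>y. y \<in> \<Omega> \<Longrightarrow> norm y \<le> M"
    using \<open>bounded \<Omega>\<close> bounded_pos by blast

  have A: "0 < A" and \<beta>0: "0 < \<beta>0" "0 < \<delta>"
    and coord: "\<And>i. i \<in> {1..m} \<Longrightarrow> coordinate_system (T i)"
    and lip: "\<And>i. i \<in> {1..m} \<Longrightarrow> A-lipschitz_on (cube \<delta>) (a i)"
    and nbhd: "\<And>i. i \<in> {1..m} \<Longrightarrow> graph_nbhd \<delta> \<beta>0 (T i) (a i) \<inter> \<Omega> =
          {p. fst (T i p) \<in> cube \<delta> \<and>
              a i (fst (T i p)) - \<beta>0 < snd (T i p) \<and> snd (T i p) < a i (fst (T i p))}"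
    and dist_graph: "\<And>i p. i \<in> {1..m} \<Longrightarrow> p \<in> graph_nbhd \<delta> \<beta>0 (T i) (a i) \<inter> \<Omega> \<Longrightarrow>
           (a i (fst (T i p)) - snd (T i p)) / (1 + A) \<le> bdist \<Omega> p \<and>
           bdist \<Omega> p \<le> a i (fst (T i p)) - snd (T i p)"
    using \<open>boundary_representation \<Omega> m T a \<delta> A \<beta>0\<close> unfolding boundary_representation_def by blast+
  have cube: "cube \<delta> = cbox (vec (- \<delta>)) (vec \<delta> :: real^'m)"
    by (auto simp: cube_def mem_box_cart abs_le_iff minus_le_iff)
  have "0 \<in> (cube \<delta> :: (real^'m) set)" using \<beta>0 by (simp add: cube_def)
  then have cube': "cube \<delta> \<noteq> ({} :: (real^'m) set)" "convex (cube \<delta> :: (real^'m) set)" "closed (cube \<delta> :: (real^'m) set)"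
    by (blast, simp_all only: cube convex_box closed_cbox)

  obtain K where "0 < K" and K:
    "\<And>x r \<mu> \<kappa> m f g. \<lbrakk>0 < r; 0 \<le> \<mu>; 0 \<le> \<kappa>; m \<in> borel_measurable borel;
        \<And>y. y \<in> ball x r \<Longrightarrow> \<mu> \<le> m y \<and> m y \<le> \<kappa> * \<mu>; C1_closure (ball x r) f g\<rbrakk> \<Longrightarrow>
      (INF \<xi>\<in>(UNIV :: real set). \<integral>\<^sup>+y\<in>ball (x :: real^'n) r. ennreal (norm y powr lam * m y * \<bar>f y - \<xi>\<bar>\<^sup>2) \<partial>lborel)
      \<le> ennreal (K * \<kappa> * r\<^sup>2) * (\<integral>\<^sup>+y\<in>ball x r. ennreal (norm y powr lam * m y * (norm (g y))\<^sup>2) \<partial>lborel)"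
    using poincare_ball_norm_powr[OF \<open>- real CARD('n) < lam\<close> \<open>lam \<le> 0\<close>] by blast

  \<comment> \<open>On an interior ball the distance to the boundary lies between
    \<open>(1 - 1 / \<gamma>)\<close> times and twice its value at the centre;
    \<open>\<kappa>\<close> is the ratio of these bounds raised to the power
    \<open>\<alpha>\<close>.\<close>
  define \<kappa> where "\<kappa> = (2 / (1 - 1 / \<gamma>)) powr \<alpha>"
  define C1 where "C1 = K * \<kappa>"
  \<comment> \<open>These constants compare \<open>w\<close> with a power of the depth on boundary
    balls, where \<open>norm y\<close> lies between \<open>bdist \<Omega> 0 / 2\<close> and
    \<open>M\<close>; the power \<open>lam \<le> 0\<close> reverses the order. The distance is at
    least the depth divided by \<open>1 + A\<close> and at most the depth.\<close>
  define c1 where "c1 = M powr lam * (1 / (1 + A)) powr \<alpha>"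
  define c2 where "c2 = (bdist \<Omega> 0 / 2) powr lam"
  define C2 where "C2 = (5 + 2 * A)\<^sup>2 * (c2 / c1 * 2 powr \<alpha>) * 2 ^ CARD('n) * 2"
  \<comment> \<open>Depths in a boundary ball stay below \<open>3 * r\<close>, as
    \<open>\<gamma> < 2\<close>. The first bound keeps the ball inside the graph neighbourhood, the
    second keeps the distance to the boundary below half its value at the origin.\<close>
  define \<beta> where "\<beta> = min (\<beta>0 / 3) (bdist \<Omega> 0 / 6)"
  have pos: "0 < c1" "0 < c2" "0 < C1" "0 < C2" "0 < \<beta>" "\<beta> \<le> \<beta>0"
    using M(1) A d0 \<open>0 < K\<close> \<open>1 < \<gamma>\<close> \<beta>0 by (auto simp: c1_def c2_def C1_def C2_def \<kappa>_def \<beta>_def)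

  have interior_ball: "(INF \<xi>\<in>(UNIV :: real set). \<integral>\<^sup>+y\<in>S. ennreal (w y * \<bar>f y - \<xi>\<bar>\<^sup>2) \<partial>lborel)
      \<le> ennreal (C1 * r\<^sup>2) * (\<integral>\<^sup>+y\<in>S. ennreal (w y * (norm (g y))\<^sup>2) \<partial>lborel)"
    if x: "x \<in> \<Omega>" and r: "0 < r" and d: "\<gamma> * r \<le> bdist \<Omega> x" and S: "S = ball x r \<inter> \<Omega>" and C1: "C1_closure S f g"
    for x r S f g
  proof -
    let ?d = "bdist \<Omega> x"
    have "r < \<gamma> * r" using r \<open>1 < \<gamma>\<close> by simp
    then have "0 < ?d" using r d by linarith
    \<comment> \<open>A ball meeting both the domain and its complement meets the frontier by
      connectedness, but the frontier is farther than \<open>r\<close> from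
      \<open>x\<close>.\<close>
    have "ball x r \<subseteq> \<Omega>"
    proof (rule ccontr)
      assume "\<not> ball x r \<subseteq> \<Omega>"
      moreover have "ball x r \<inter> \<Omega> \<noteq> {}" using x centre_in_ball[of x r] r by blast
      ultimately obtain z where "z \<in> ball x r" "z \<in> frontier \<Omega>"
        using connected_Int_frontier[OF connected_ball, of x r \<Omega>] by blast
      then have "?d < r" using infdist_le[of z "frontier \<Omega>" x] by (simp add: bdist_def)
      then show False using d \<open>r < \<gamma> * r\<close> by linarith
    qed
    then have S: "S = ball x r" using S by blast
    have g: "0 < 1 - 1 / \<gamma>" using \<open>1 < \<gamma>\<close> by simp
    have "r \<le> ?d / \<gamma>" using d \<open>1 < \<gamma>\<close> by (simp add: field_simps)
    show ?thesis
      unfolding S w_def C1_def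
    proof (rule K[where \<mu> = "((1 - 1 / \<gamma>) * ?d) powr \<alpha>"])
      fix y assume "y \<in> ball x r"
      then have "\<bar>bdist \<Omega> y - ?d\<bar> < r" using bdist_diff[of y x] by (simp add: dist_commute)
      then have "(1 - 1 / \<gamma>) * ?d \<le> bdist \<Omega> y" "bdist \<Omega> y \<le> 2 * ?d"
        using \<open>r \<le> ?d / \<gamma>\<close> \<open>r < \<gamma> * r\<close> d by (auto simp: algebra_simps)
      then have "((1 - 1 / \<gamma>) * ?d) powr \<alpha> \<le> bdist \<Omega> y powr \<alpha>" "bdist \<Omega> y powr \<alpha> \<le> (2 * ?d) powr \<alpha>"
        using g \<open>0 < ?d\<close> \<open>\<alpha> > 0\<close> bdist_nonneg by (auto intro!: powr_mono2)
      moreover have "\<kappa> * ((1 - 1 / \<gamma>) * ?d) powr \<alpha> = (2 / (1 - 1 / \<gamma>) * ((1 - 1 / \<gamma>) * ?d)) powr \<alpha>"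
        unfolding \<kappa>_def using g \<open>0 < ?d\<close> by (intro powr_mult[symmetric])
      moreover have "2 / (1 - 1 / \<gamma>) * ((1 - 1 / \<gamma>) * ?d) = 2 * ?d"
        using \<open>1 < \<gamma>\<close> by simp
      ultimately show "((1 - 1 / \<gamma>) * ?d) powr \<alpha> \<le> bdist \<Omega> y powr \<alpha> \<and>
          bdist \<Omega> y powr \<alpha> \<le> \<kappa> * ((1 - 1 / \<gamma>) * ?d) powr \<alpha>" by simp
    qed (use r C1 S in \<open>auto simp: \<kappa>_def\<close>)
  qed

  have boundary_ball: "(INF \<xi>\<in>(UNIV :: real set). \<integral>\<^sup>+y\<in>S. ennreal (w y * \<bar>f y - \<xi>\<bar>\<^sup>2) \<partial>lborel)
      \<le> ennreal (C2 * r\<^sup>2) * (\<integral>\<^sup>+y\<in>S. ennreal (w y * (norm (g y))\<^sup>2) \<partial>lborel)"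
    if r: "0 < r" "r < \<beta>" and d: "bdist \<Omega> x < \<gamma> * r" and i: "i \<in> {1..m}"
      and S: "S = gen_ball \<Omega> \<gamma> \<delta> (T i) (a i) x r \<inter> \<Omega>" and C1: "C1_closure S f g"
    for x r i S f g
  proof -
    let ?d = "bdist \<Omega> x"
    have d2: "?d < 2 * r" using d mult_strict_right_mono[OF \<open>\<gamma> < 2\<close> r(1)] by linarith
    \<comment> \<open>Nothing is assumed of \<open>a i\<close> outside the cube; this is a Lipschitz extension.\<close>
    define b where "b v = a i (closest_point (cube \<delta>) v)" for v
    have ba: "b v = a i v" if "v \<in> cube \<delta>" for v
      using that cube' by (simp add: b_def closest_point_self)
    have lipb: "A-lipschitz_on UNIV b"
    proof (rule lipschitz_onI)
      fix v v' :: "real^'m"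
      have "dist (b v) (b v') \<le> A * dist (closest_point (cube \<delta>) v) (closest_point (cube \<delta>) v')"
        unfolding b_def using cube' by (intro lipschitz_onD[OF lip[OF i]] closest_point_in_set) auto
      also have "\<dots> \<le> A * dist v v'"
        using cube' A by (intro mult_left_mono closest_point_lipschitz) auto
      finally show "dist (b v) (b v') \<le> A * dist v v'" .
    qed (use A in simp)
    \<comment> \<open>The point \<open>fst (T i x)\<close> need not lie in the cube, so this
      intersection can be a thin piece of it; the cylinder lemma admits any closed convex set in the
      ball.\<close>
    define K' where "K' = cube \<delta> \<inter> cball (fst (T i x)) r"
    have r3: "3 * r < \<beta>0" "3 * r < bdist \<Omega> 0 / 2" using r by (auto simp: \<beta>_def)
    \<comment> \<open>In terms of the depth, the two inequalities of \<open>gen_ball\<close> place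
      it strictly between \<open>?d - r\<close> and \<open>?d + r\<close>. Intersecting with the
      domain makes it positive, whence the maximum.\<close>
    have S_eq: "S = {y. fst (T i y) \<in> K' \<and> max 0 (?d - r) < b (fst (T i y)) - snd (T i y)
        \<and> b (fst (T i y)) - snd (T i y) < ?d + r}" (is "S = ?R")
    proof (intro set_eqI iffI)
      fix y assume y: "y \<in> S"
      then have *: "fst (T i y) \<in> cube \<delta>" "norm (fst (T i y) - fst (T i x)) \<le> r"
        "a i (fst (T i y)) - r - ?d < snd (T i y)" "snd (T i y) < a i (fst (T i y)) + r - ?d" "y \<in> \<Omega>"
        using d by (auto simp: S gen_ball_def)
      have "y \<in> graph_nbhd \<delta> \<beta>0 (T i) (a i)"
        using * r r3 d2 bdist_nonneg[of x] by (auto simp: graph_nbhd_def)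
      then have "snd (T i y) < a i (fst (T i y))"
        using nbhd[OF i] \<open>y \<in> \<Omega>\<close> by blast
      then show "y \<in> ?R" using * by (auto simp: K'_def ba dist_norm norm_minus_commute)
    next
      fix y assume "y \<in> ?R"
      then have *: "fst (T i y) \<in> cube \<delta>" "norm (fst (T i y) - fst (T i x)) \<le> r"
        "max 0 (?d - r) < a i (fst (T i y)) - snd (T i y)" "a i (fst (T i y)) - snd (T i y) < ?d + r"
        by (auto simp: K'_def ba dist_norm norm_minus_commute)
      then have "y \<in> graph_nbhd \<delta> \<beta>0 (T i) (a i) \<inter> \<Omega>"
        unfolding nbhd[OF i] using r3 d2 by auto
      then show "y \<in> S" using * d by (auto simp: S gen_ball_def)
    qed
    show ?thesis
      unfolding C2_def
    proof (rule poincare_graph_cylinder[where T = "T i" and b = b and K = K' and ?t0.0 = "max 0 (?d - r)"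
          and ?t1.0 = "?d + r", OF \<open>CARD('n) = CARD('m) + 1\<close> coord[OF i] lipb])
      show "convex K'" "closed K'" "K' \<subseteq> cball (fst (T i x)) r"
        using cube' by (auto simp: K'_def intro: convex_Int closed_Int)
      show "max 0 (?d - r) < ?d + r" "?d + r \<le> 3 * r" using r d2 bdist_nonneg[of x] by auto
      fix y assume y: "y \<in> S"
      let ?t = "b (fst (T i y)) - snd (T i y)"
      have t: "0 < ?t" "?t < ?d + r" and "fst (T i y) \<in> cube \<delta>"
        using y by (auto simp: S_eq K'_def)
      then have "y \<in> graph_nbhd \<delta> \<beta>0 (T i) (a i) \<inter> \<Omega>"
        unfolding nbhd[OF i] using r3 d2 by (auto simp: ba)
      then have dy: "?t / (1 + A) \<le> bdist \<Omega> y" "bdist \<Omega> y \<le> ?t" and "norm y \<le> M"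
        using dist_graph[OF i] M \<open>fst (T i y) \<in> cube \<delta>\<close> by (auto simp: ba)
      \<comment> \<open>The distance to the boundary is 1-Lipschitz and at \<open>y\<close> is less
        than half its value at the origin.\<close>
      have "bdist \<Omega> 0 / 2 \<le> norm y"
        using bdist_diff[of 0 y] dy t d2 r3 by (auto simp: dist_norm)
      then have ny: "M powr lam \<le> norm y powr lam" "norm y powr lam \<le> c2"
        unfolding c2_def using d0 \<open>norm y \<le> M\<close> \<open>lam \<le> 0\<close> by (auto intro!: powr_mono2')
      have "(1 / (1 + A)) powr \<alpha> * ?t powr \<alpha> = (?t / (1 + A)) powr \<alpha>"
        using A t by (subst powr_mult[symmetric]) auto
      also have "\<dots> \<le> bdist \<Omega> y powr \<alpha>"
        using A t dy \<open>\<alpha> > 0\<close> by (intro powr_mono2) auto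
      finally have low: "(1 / (1 + A)) powr \<alpha> * ?t powr \<alpha> \<le> bdist \<Omega> y powr \<alpha>" .
      have up: "bdist \<Omega> y powr \<alpha> \<le> ?t powr \<alpha>"
        using dy \<open>\<alpha> > 0\<close> bdist_nonneg by (intro powr_mono2) auto
      show "c1 * ?t powr \<alpha> \<le> w y \<and> w y \<le> c2 * ?t powr \<alpha>"
        unfolding w_def c1_def mult.assoc using ny low up pos by (auto intro!: mult_mono)
    qed (use S_eq C1 pos \<open>\<alpha> > 0\<close> in auto)
  qed

  show ?thesis
  \<comment> \<open>The sum dominates the constants of both kinds of balls.\<close>
  proof (rule exI[of _ "C1 + C2"], rule exI[of _ \<beta>], intro conjI ballI allI impI)
    show "0 < C1 + C2" "0 < \<beta>" "\<beta> \<le> \<beta>0" using pos by auto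
    fix x r i S f g
    assume x: "x \<in> \<Omega>" and r: "0 < r \<and> r < \<beta>" and i: "projection_index \<Omega> m T a \<delta> x i"
      and S: "S = gen_ball \<Omega> \<gamma> \<delta> (T i) (a i) x r \<inter> \<Omega>" and f: "C1_closure S f g"
    let ?X = "INF \<xi>\<in>(UNIV :: real set). \<integral>\<^sup>+y\<in>S. ennreal (w y * \<bar>f y - \<xi>\<bar>\<^sup>2) \<partial>lborel"
    let ?I = "\<integral>\<^sup>+y\<in>S. ennreal (w y * (norm (g y))\<^sup>2) \<partial>lborel"
    have "?X \<le> ennreal (C1 * r\<^sup>2) * ?I \<or> ?X \<le> ennreal (C2 * r\<^sup>2) * ?I"
    proof (cases "\<gamma> * r \<le> bdist \<Omega> x")
      case True
      then show ?thesis using interior_ball[of x r S f g] x r S f by (simp add: gen_ball_def)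
    next
      case False
      then show ?thesis using boundary_ball[of r x i S f g] r S f i by (simp add: projection_index_def)
    qed
    moreover have "ennreal (C1 * r\<^sup>2) * ?I \<le> ennreal ((C1 + C2) * r\<^sup>2) * ?I"
      "ennreal (C2 * r\<^sup>2) * ?I \<le> ennreal ((C1 + C2) * r\<^sup>2) * ?I"
      using pos by (intro mult_right_mono ennreal_leI; simp)+
    ultimately show "(INF \<xi>\<in>(UNIV :: real set).
            \<integral>\<^sup>+ y \<in> S. ennreal (norm y powr lam * bdist \<Omega> y powr \<alpha> * \<bar>f y - \<xi>\<bar>\<^sup>2) \<partial>lborel)
         \<le> ennreal ((C1 + C2) * r\<^sup>2) *
            (\<integral>\<^sup>+ y \<in> S. ennreal (norm y powr lam * bdist \<Omega> y powr \<alpha> * (norm (g y))\<^sup>2) \<partial>lborel)"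
      unfolding w_def by (auto intro: order_trans)
  qed
qed

end
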